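(* Let $k\geq 1$ be an odd integer and let $G$ be a connected graph of even order $n\geq 6$. (i) If $6\le n\le 8$ and $\lambda_1(D(G))\le \lambda_1(D(S_{n,\frac{n}{2}-1}))$, then $G$ has a perfect $k$-matching unless $G\cong S_{n,\frac{n}{2}-1}$. (ii) If $n\geq 10$ and $\lambda_1(D(G))\le \lambda_1(D(K_1\vee(K_{n-3}\cup 2K_1)))$, then $G$ has a perfect $k$-matching unless $G\cong K_1\vee(K_{n-3}\cup 2K_1)$.
   Context: All graphs are finite, simple, undirected. For a connected graph $G$ with vertices $v_1,\dots,v_n$, the distance matrix $D(G)$ is the $n\times n$ matrix whose $(i,j)$-entry is the distance $d_G(v_i,v_j)$; $\lambda_1(D(G))$ denotes its largest eigenvalue (the distance spectral radius). $G\cup H$ is the disjoint union, $G\vee H$ the join (disjoint union plus all edges between $V(G)$ and $V(H)$), $tK_1$ is the edgeless graph on $t$ vertices, and $S_{n,k}=K_k\vee (n-k)K_1$. For a vertex $v$, $E_G(v)$ is the set of edges incident with $v$. A $k$-matching of $G$ is a function $f:E(G)\to\{0,1,\dots,k\}$ with $\sum_{e\in E_G(v)}f(e)\le k$ for every $v\in V(G)$; it is perfect if $\sum_{e\in E_G(v)}f(e)=k$ for every $v\in V(G)$. *)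

theory Defs
  imports Complex_Main
begin

definition simple_graph :: "'a set \<Rightarrow> 'a set set \<Rightarrow> bool" where
  "simple_graph V E \<longleftrightarrow> finite V \<and>
     (\<forall>e\<in>E. \<exists>u v. e = {u, v} \<and> u \<noteq> v \<and> u \<in> V \<and> v \<in> V)"

definition is_walk :: "'a set \<Rightarrow> 'a set set \<Rightarrow> 'a list \<Rightarrow> bool" where
  "is_walk V E xs \<longleftrightarrow> xs \<noteq> [] \<and> set xs \<subseteq> V \<and>
     (\<forall>i. Suc i < length xs \<longrightarrow> {xs ! i, xs ! Suc i} \<in> E)"

definition connected_graph :: "'a set \<Rightarrow> 'a set set \<Rightarrow> bool" where
  "connected_graph V E \<longleftrightarrow> V \<noteq> {} \<and>
     (\<forall>u\<in>V. \<forall>v\<in>V. \<exists>xs. is_walk V E xs \<and> hd xs = u \<and> last xs = v)"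

definition gdist :: "'a set \<Rightarrow> 'a set set \<Rightarrow> 'a \<Rightarrow> 'a \<Rightarrow> nat" where
  "gdist V E u v = (LEAST n. \<exists>xs. is_walk V E xs \<and> hd xs = u \<and> last xs = v \<and> length xs = Suc n)"

definition dist_eigenvalue :: "'a set \<Rightarrow> 'a set set \<Rightarrow> real \<Rightarrow> bool" where
  "dist_eigenvalue V E \<mu> \<longleftrightarrow> (\<exists>x :: 'a \<Rightarrow> real. (\<exists>v\<in>V. x v \<noteq> 0) \<and>
     (\<forall>u\<in>V. (\<Sum>v\<in>V. real (gdist V E u v) * x v) = \<mu> * x u))"

text \<open>Distance spectral radius: the largest eigenvalue of D(G) (D(G) is real symmetric,
  so all its eigenvalues are real).\<close>

definition dist_spectral_radius :: "'a set \<Rightarrow> 'a set set \<Rightarrow> real" where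
  "dist_spectral_radius V E = Max {\<mu>. dist_eigenvalue V E \<mu>}"

definition incident_edges :: "'a set set \<Rightarrow> 'a \<Rightarrow> 'a set set" where
  "incident_edges E v = {e\<in>E. v \<in> e}"

definition k_matching :: "'a set \<Rightarrow> 'a set set \<Rightarrow> nat \<Rightarrow> ('a set \<Rightarrow> nat) \<Rightarrow> bool" where
  "k_matching V E k f \<longleftrightarrow> (\<forall>e\<in>E. f e \<le> k) \<and>
     (\<forall>v\<in>V. (\<Sum>e\<in>incident_edges E v. f e) \<le> k)"

definition perfect_k_matching :: "'a set \<Rightarrow> 'a set set \<Rightarrow> nat \<Rightarrow> ('a set \<Rightarrow> nat) \<Rightarrow> bool" where
  "perfect_k_matching V E k f \<longleftrightarrow> k_matching V E k f \<and>
     (\<forall>v\<in>V. (\<Sum>e\<in>incident_edges E v. f e) = k)"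

definition has_perfect_k_matching :: "'a set \<Rightarrow> 'a set set \<Rightarrow> nat \<Rightarrow> bool" where
  "has_perfect_k_matching V E k \<longleftrightarrow> (\<exists>f. perfect_k_matching V E k f)"

definition graph_iso :: "'a set \<Rightarrow> 'a set set \<Rightarrow> 'b set \<Rightarrow> 'b set set \<Rightarrow> bool" where
  "graph_iso V E V' E' \<longleftrightarrow> (\<exists>f. bij_betw f V V' \<and>
     (\<forall>u\<in>V. \<forall>v\<in>V. {u, v} \<in> E \<longleftrightarrow> {f u, f v} \<in> E'))"

definition cverts :: "nat \<Rightarrow> nat set" where
  "cverts n = {0..<n}"

text \<open>S_{n,k} = K_k join (n-k)K_1: vertices 0..k-1 form the clique.\<close>

definition S_edges :: "nat \<Rightarrow> nat \<Rightarrow> nat set set" where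
  "S_edges n k = {{i, j} | i j. i < n \<and> j < n \<and> i \<noteq> j \<and> (i < k \<or> j < k)}"

text \<open>K_1 join (K_{n-3} union 2K_1): vertex 0 is the K_1, vertices 1..n-3 form K_{n-3},
  vertices n-2 and n-1 are the two isolated vertices of the union.\<close>

definition H_edges :: "nat \<Rightarrow> nat set set" where
  "H_edges n = {{i, j} | i j. i < n \<and> j < n \<and> i \<noteq> j \<and>
     (i = 0 \<or> j = 0 \<or> (i \<le> n - 3 \<and> j \<le> n - 3))}"

end

theory Submission
  imports Defs "HOL-Analysis.Function_Topology"
begin

text \<open>
  A perfect matching taken \<open>k\<close> times is a perfect \<open>k\<close>-matching, so assume that \<open>G\<close> has no perfect
  matching. By Tutte's theorem some set \<open>S\<close> of \<open>s\<close> vertices leaves at least \<open>s + 2\<close> classes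
  with no edges between them, and \<open>s \<ge> 1\<close> since \<open>G\<close> is connected. Let \<open>I\<close> consist of one vertex from
  each of \<open>s + 1\<close> classes other than the largest one and let \<open>R\<close> be the rest. For test vectors that
  are constant on \<open>R\<close> and at most twice that constant on \<open>I\<close>, the quadratic form of the distance matrix
  of \<open>G\<close> dominates that of \<open>K\<^sub>s \<or> (K\<^sub>r \<union> (s+1) K\<^sub>1)\<close> on \<open>S, R, I\<close>. By the Rayleigh principle it is enough
  to insert vectors close to the Perron vector of the extremal graph, and the exact Perron vector
  yields the equality case.
\<close>

section \<open>Eigenvalues of real symmetric kernels on a finite set\<close>

text \<open>Tutte's theorem does not control \<open>s\<close>, so all split graphs with
  \<open>n = 2 * s + 1 + r\<close> compete. The one of least spectral radius jumps from one end of
  this range, \<open>r = 1\<close>, to the other, \<open>s = 1\<close>, between \<open>n = 8\<close>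
  and \<open>n = 10\<close>, which is why there are two extremal graphs. Only the extremal graph
  needs an upper bound on its spectral radius, and a positive eigenvector supplies it. A competitor
  needs only a lower bound, which any admissible test vector supplies, so its own Perron vector
  never has to be computed. The factor 2 in the restriction on test vectors comes from a defect of
  the comparison: a leftover vertex of a class may be adjacent to the representative of that class,
  where the split graph has distance 2. This loss is paid for by the distances from the leftover
  vertex to at least two vertices of the largest class. For \<open>n \<ge> 10\<close> one identity
  excludes all competitors except \<open>s = r = 3\<close> and the graphs with \<open>r = 1\<close>
  and \<open>n \<le> 16\<close>; these are excluded by numerical estimates.\<close>

definition sqnorm_on :: "'a set \<Rightarrow> ('a \<Rightarrow> real) \<Rightarrow> real" where
  "sqnorm_on V x = (\<Sum>v\<in>V. (x v)\<^sup>2)"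

definition bform_on :: "'a set \<Rightarrow> ('a \<Rightarrow> 'a \<Rightarrow> real) \<Rightarrow> ('a \<Rightarrow> real) \<Rightarrow> real" where
  "bform_on V d x = (\<Sum>u\<in>V. \<Sum>v\<in>V. d u v * x u * x v)"

lemma sqnorm_on_pos:
  assumes "finite V" "v \<in> V" "x v \<noteq> 0"
  shows "sqnorm_on V x > 0"
  unfolding sqnorm_on_def using assms by (intro sum_pos2[of V v]) auto

text \<open>Forcing the functions to vanish off \<open>V\<close> makes the sphere a closed subset of
  a product of compact intervals and singletons, so Tychonoff's theorem applies. Free values off
  \<open>V\<close> would be unbounded coordinates.\<close>

lemma compact_unit_sphere_on:
  fixes V :: "'a set"
  assumes "finite V"
  shows "compact {x :: 'a \<Rightarrow> real. (\<forall>v. v \<notin> V \<longrightarrow> x v = 0) \<and> sqnorm_on V x = 1}"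
proof -
  define B where "B = PiE UNIV (\<lambda>v. if v \<in> V then {-1..1::real} else {0})"
  have "compactin (product_topology (\<lambda>v::'a. euclidean :: real topology) UNIV) B"
    unfolding B_def by (subst compactin_PiE) auto
  then have cB: "compact B"
    by (simp add: euclidean_product_topology)
  have "continuous_on UNIV (\<lambda>x. sqnorm_on V x)"
    unfolding sqnorm_on_def by (intro continuous_intros continuous_on_product_coordinates)
  then have "closed {x. sqnorm_on V x = 1}"
    by (intro closed_Collect_eq continuous_on_const)
  then have "compact (B \<inter> {x. sqnorm_on V x = 1})"
    using cB by (rule compact_Int_closed[rotated])
  moreover have "{x :: 'a \<Rightarrow> real. (\<forall>v. v \<notin> V \<longrightarrow> x v = 0) \<and> sqnorm_on V x = 1}
      = B \<inter> {x. sqnorm_on V x = 1}"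
  proof -
    have "\<bar>x v\<bar> \<le> 1" if "sqnorm_on V x = 1" "v \<in> V" for x v
    proof -
      have "(x v)\<^sup>2 \<le> sqnorm_on V x"
        unfolding sqnorm_on_def using assms that(2) by (intro member_le_sum) auto
      then show ?thesis
        using that(1) by (simp add: abs_square_le_1)
    qed
    then show ?thesis
      unfolding B_def by (fastforce simp: PiE_iff abs_le_iff split: if_splits)
  qed
  ultimately show ?thesis by simp
qed

lemma bform_on_scale: "bform_on V d (\<lambda>v. t * x v) = t\<^sup>2 * bform_on V d x"
  unfolding bform_on_def sum_distrib_left by (intro sum.cong) (auto simp: power2_eq_square)

lemma sqnorm_on_scale: "sqnorm_on V (\<lambda>v. t * x v) = t\<^sup>2 * sqnorm_on V x"
  unfolding sqnorm_on_def sum_distrib_left by (simp add: power_mult_distrib)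

lemma bform_on_perturb:
  assumes "finite V" "w \<in> V" and sym: "\<And>u v. u \<in> V \<Longrightarrow> v \<in> V \<Longrightarrow> d u v = d v u"
  shows "bform_on V d (\<lambda>v. x v + (if v = w then t else 0))
    = bform_on V d x + 2 * t * (\<Sum>v\<in>V. d w v * x v) + t\<^sup>2 * d w w"
proof -
  let ?e = "\<lambda>v. if v = w then t else 0"
  have "bform_on V d (\<lambda>v. x v + ?e v) = (\<Sum>u\<in>V. \<Sum>v\<in>V. d u v * x u * x v
      + (d u v * x u * ?e v) + (d u v * ?e u * x v) + d u v * ?e u * ?e v)"
    unfolding bform_on_def by (intro sum.cong) (auto simp: algebra_simps)
  also have "\<dots> = bform_on V d x + (\<Sum>u\<in>V. \<Sum>v\<in>V. d u v * x u * ?e v)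
     + (\<Sum>u\<in>V. \<Sum>v\<in>V. d u v * ?e u * x v) + (\<Sum>u\<in>V. \<Sum>v\<in>V. d u v * ?e u * ?e v)"
    unfolding bform_on_def by (simp add: sum.distrib)
  also have "(\<Sum>u\<in>V. \<Sum>v\<in>V. d u v * x u * ?e v) = (\<Sum>u\<in>V. d u w * x u * t)"
    using assms(1,2) by (simp add: if_distrib[of "\<lambda>z. _ * z"] cong: if_cong)
  also have "\<dots> = t * (\<Sum>v\<in>V. d w v * x v)"
    unfolding sum_distrib_left using assms(2) sym by (intro sum.cong) auto
  also have "(\<Sum>u\<in>V. \<Sum>v\<in>V. d u v * ?e u * x v) = (\<Sum>v\<in>V. \<Sum>u\<in>V. d u v * ?e u * x v)"
    by (rule sum.swap)
  also have "\<dots> = (\<Sum>v\<in>V. d w v * t * x v)"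
    using assms(1,2)
    by (simp add: if_distrib[of "\<lambda>z. _ * z"] if_distrib[of "\<lambda>z. z * _"] cong: if_cong)
  also have "\<dots> = t * (\<Sum>v\<in>V. d w v * x v)"
    unfolding sum_distrib_left by (intro sum.cong) auto
  also have "(\<Sum>u\<in>V. \<Sum>v\<in>V. d u v * ?e u * ?e v) = d w w * t * t"
    using assms(1,2)
    by (simp add: if_distrib[of "\<lambda>z. _ * z"] if_distrib[of "\<lambda>z. z * _"] cong: if_cong)
  finally show ?thesis
    by (simp add: algebra_simps power2_eq_square)
qed

lemma quadratic_nonneg_imp_linear_zero:
  fixes p q :: real
  assumes "\<And>t. p * t + q * t\<^sup>2 \<ge> 0"
  shows "p = 0"
proof (rule ccontr)
  assume "p \<noteq> 0"
  \<comment> \<open>As \<open>r\<close> exceeds the absolute value of \<open>q\<close>, the linear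
    term outweighs the quadratic one at \<open>t = - p / r\<close>.\<close>
  define r where "r = 2 * (\<bar>q\<bar> + 1)"
  have r: "r > 0" "\<bar>q\<bar> < r" by (auto simp: r_def)
  have "p * (- p / r) + q * (- p / r)\<^sup>2 = (p\<^sup>2 / r) * (q / r - 1)"
    using r by (simp add: field_simps power2_eq_square)
  moreover have "p\<^sup>2 / r > 0" using \<open>p \<noteq> 0\<close> r by simp
  moreover have "q / r - 1 < 0" using r by (simp add: field_simps)
  ultimately have "p * (- p / r) + q * (- p / r)\<^sup>2 < 0"
    using mult_pos_neg by metis
  then show False using assms[of "- p / r"] by linarith
qed

text \<open>A maximiser of the form on the unit sphere is an eigenvector: under a change of one
  coordinate by \<open>t\<close> the difference
  \<open>\<mu> * sqnorm_on V z - bform_on V d z\<close> stays nonnegative and is zero at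
  \<open>t = 0\<close>, so its linear coefficient vanishes. This coefficient is twice the defect in
  the eigenvalue equation at that coordinate.\<close>

lemma exists_top_eigenpair:
  fixes V :: "'a set"
  assumes "finite V" "V \<noteq> {}" and sym: "\<And>u v. u \<in> V \<Longrightarrow> v \<in> V \<Longrightarrow> d u v = d v u"
  shows "\<exists>\<mu> x. (\<exists>v\<in>V. x v \<noteq> 0) \<and> (\<forall>u\<in>V. (\<Sum>v\<in>V. d u v * x v) = \<mu> * x u) \<and>
    (\<forall>z. bform_on V d z \<le> \<mu> * sqnorm_on V z)"
proof -
  define K where "K = {x :: 'a \<Rightarrow> real. (\<forall>v. v \<notin> V \<longrightarrow> x v = 0) \<and> sqnorm_on V x = 1}"
  have cK: "compact K"
    unfolding K_def by (rule compact_unit_sphere_on) fact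
  obtain w0 where w0: "w0 \<in> V" using assms(2) by auto
  have "(\<lambda>v. if v = w0 then 1 else 0) \<in> K"
  proof -
    have "(\<Sum>v\<in>V. ((if v = w0 then 1 else 0)::real)\<^sup>2) = (\<Sum>v\<in>V. if v = w0 then 1 else 0)"
      by (intro sum.cong) auto
    then show ?thesis
      unfolding K_def sqnorm_on_def using w0 assms(1) by auto
  qed
  then have "K \<noteq> {}" by auto
  moreover have "continuous_on UNIV (bform_on V d)"
    unfolding bform_on_def by (intro continuous_intros continuous_on_product_coordinates)
  then have "continuous_on K (bform_on V d)"
    by (rule continuous_on_subset) auto
  ultimately obtain x where x: "x \<in> K" and mx: "\<And>y. y \<in> K \<Longrightarrow> bform_on V d y \<le> bform_on V d x"
    using continuous_attains_sup[OF cK] by blast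
  define \<mu> where "\<mu> = bform_on V d x"
  have x1: "sqnorm_on V x = 1" using x by (simp add: K_def)
  have ray: "bform_on V d z \<le> \<mu> * sqnorm_on V z" for z
  proof (cases "\<exists>v\<in>V. z v \<noteq> 0")
    case False
    then have "bform_on V d z = 0" "sqnorm_on V z = 0"
      unfolding bform_on_def sqnorm_on_def by auto
    then show ?thesis by simp
  next
    case True
    then obtain v where "v \<in> V" "z v \<noteq> 0" by auto
    then have pos: "sqnorm_on V z > 0" by (rule sqnorm_on_pos[OF assms(1)])
    define t where "t = 1 / sqrt (sqnorm_on V z)"
    have t2: "t\<^sup>2 = 1 / sqnorm_on V z"
      unfolding t_def using pos by (simp add: power_divide)
    define z' where "z' = (\<lambda>v. if v \<in> V then t * z v else 0)"
    have e1: "bform_on V d z' = bform_on V d (\<lambda>v. t * z v)"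
      unfolding bform_on_def z'_def by (intro sum.cong) auto
    have e2: "sqnorm_on V z' = sqnorm_on V (\<lambda>v. t * z v)"
      unfolding sqnorm_on_def z'_def by (intro sum.cong) auto
    have "z' \<in> K"
      unfolding K_def using pos t2 by (auto simp: e2 sqnorm_on_scale) (auto simp: z'_def)
    then have "bform_on V d z' \<le> \<mu>"
      unfolding \<mu>_def by (rule mx)
    then have "bform_on V d z / sqnorm_on V z \<le> \<mu>"
      by (simp add: e1 bform_on_scale t2)
    then show ?thesis
      using pos by (simp add: pos_divide_le_eq)
  qed
  have "(\<Sum>v\<in>V. d w v * x v) = \<mu> * x w" if w: "w \<in> V" for w
  proof -
    let ?S = "\<Sum>v\<in>V. d w v * x v"
    have "(2 * (\<mu> * x w - ?S)) * t + (\<mu> - d w w) * t\<^sup>2 \<ge> 0" for t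
    proof -
      \<comment> \<open>Reading the squared norm as the form of the identity kernel lets
        \<open>bform_on_perturb\<close> expand both sides.\<close>
      have sq: "sqnorm_on V y = bform_on V (\<lambda>u v. if u = v then 1 else 0) y" for y
        unfolding sqnorm_on_def bform_on_def using assms(1)
        by (intro sum.cong)
           (auto simp: if_distrib[of "\<lambda>z. z * _"] power2_eq_square cong: if_cong)
      have "sqnorm_on V (\<lambda>v. x v + (if v = w then t else 0)) = 1 + 2 * t * x w + t\<^sup>2"
        unfolding sq using w assms(1) x1[unfolded sq]
        by (subst bform_on_perturb)
           (auto simp: if_distrib[of "\<lambda>z. z * _"] cong: if_cong)
      then show ?thesis
        using ray[of "\<lambda>v. x v + (if v = w then t else 0)"]
          bform_on_perturb[where d = d and x = x and t = t, OF assms(1) w sym]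
        by (simp add: \<mu>_def[symmetric] algebra_simps)
    qed
    then have "2 * (\<mu> * x w - ?S) = 0"
      by (rule quadratic_nonneg_imp_linear_zero)
    then show ?thesis by simp
  qed
  moreover have "\<exists>v\<in>V. x v \<noteq> 0"
  proof (rule ccontr)
    assume "\<not> (\<exists>v\<in>V. x v \<noteq> 0)"
    then have "sqnorm_on V x = 0" by (simp add: sqnorm_on_def)
    then show False using x1 by simp
  qed
  ultimately show ?thesis
    using ray by (intro exI[of _ \<mu>] exI[of _ x]) simp
qed

text \<open>Bessel's inequality for the point mass at \<open>w\<close> bounds the sum of
  \<open>(e i w)\<^sup>2\<close> over \<open>i\<close> by 1. Summing over \<open>w\<close> counts
  each unit vector once.\<close>

lemma card_orthonormal_le:
  fixes e :: "'b \<Rightarrow> 'a \<Rightarrow> real"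
  assumes "finite V" "finite A"
    and "\<And>i j. i \<in> A \<Longrightarrow> j \<in> A \<Longrightarrow> (\<Sum>v\<in>V. e i v * e j v) = (if i = j then 1 else 0)"
  shows "card A \<le> card V"
proof -
  have bessel: "(\<Sum>i\<in>A. (e i w)\<^sup>2) \<le> 1" if w: "w \<in> V" for w
  proof -
    let ?p = "\<lambda>v. \<Sum>i\<in>A. e i w * e i v"
    let ?\<delta> = "\<lambda>v. if v = w then 1 else (0::real)"
    have "0 \<le> (\<Sum>v\<in>V. (?\<delta> v - ?p v)\<^sup>2)" by (intro sum_nonneg) auto
    also have "\<dots> = (\<Sum>v\<in>V. ?\<delta> v - 2 * (if v = w then ?p v else 0) + (?p v)\<^sup>2)"
      by (intro sum.cong) (auto simp: power2_eq_square algebra_simps)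
    also have "\<dots> = 1 - 2 * ?p w + (\<Sum>v\<in>V. (?p v)\<^sup>2)"
      using w assms(1) by (simp add: sum.distrib sum_subtractf sum_distrib_left[symmetric])
    also have "(\<Sum>v\<in>V. (?p v)\<^sup>2) = (\<Sum>v\<in>V. \<Sum>i\<in>A. \<Sum>j\<in>A. e i w * e j w * (e i v * e j v))"
      by (intro sum.cong) (auto simp: power2_eq_square sum_product algebra_simps)
    also have "\<dots> = (\<Sum>i\<in>A. \<Sum>v\<in>V. \<Sum>j\<in>A. e i w * e j w * (e i v * e j v))"
      by (rule sum.swap)
    also have "\<dots> = (\<Sum>i\<in>A. \<Sum>j\<in>A. \<Sum>v\<in>V. e i w * e j w * (e i v * e j v))"
      by (intro sum.cong sum.swap) auto
    also have "\<dots> = (\<Sum>i\<in>A. \<Sum>j\<in>A. e i w * e j w * (if i = j then 1 else 0))"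
      by (intro sum.cong) (auto simp: sum_distrib_left[symmetric] assms(3))
    also have "\<dots> = ?p w"
      using assms(2) by (simp add: if_distrib[of "\<lambda>z. _ * z"] cong: if_cong)
    finally show ?thesis by (simp add: power2_eq_square)
  qed
  have "real (card A) = (\<Sum>i\<in>A. \<Sum>v\<in>V. e i v * e i v)"
    using assms(3) by simp
  also have "\<dots> = (\<Sum>v\<in>V. \<Sum>i\<in>A. (e i v)\<^sup>2)"
    by (subst sum.swap) (simp add: power2_eq_square)
  also have "\<dots> \<le> (\<Sum>v\<in>V. 1)"
    by (intro sum_mono bessel)
  finally show ?thesis by simp
qed

text \<open>Eigenvectors of distinct eigenvalues are orthogonal, so there are at most
  \<open>card V\<close> eigenvalues. Finiteness is what gives the \<open>Max\<close> in
  \<open>dist_spectral_radius\<close> its meaning.\<close>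

lemma finite_eigenvalues:
  fixes V :: "'a set" and d :: "'a \<Rightarrow> 'a \<Rightarrow> real"
  assumes "finite V" and sym: "\<And>u v. u \<in> V \<Longrightarrow> v \<in> V \<Longrightarrow> d u v = d v u"
  shows "finite {\<mu>. \<exists>x. (\<exists>v\<in>V. x v \<noteq> 0) \<and> (\<forall>u\<in>V. (\<Sum>v\<in>V. d u v * x v) = \<mu> * x u)}"
    (is "finite ?L")
proof (rule ccontr)
  assume "infinite ?L"
  then obtain A where A: "A \<subseteq> ?L" "finite A" "card A = Suc (card V)"
    using infinite_arbitrarily_large by blast
  have "\<forall>\<mu>\<in>A. \<exists>x. (\<exists>v\<in>V. x v \<noteq> 0) \<and> (\<forall>u\<in>V. (\<Sum>v\<in>V. d u v * x v) = \<mu> * x u)"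
    using A(1) by auto
  then obtain x where x: "\<And>\<mu>. \<mu> \<in> A \<Longrightarrow> \<exists>v\<in>V. x \<mu> v \<noteq> 0"
    "\<And>\<mu> u. \<mu> \<in> A \<Longrightarrow> u \<in> V \<Longrightarrow> (\<Sum>v\<in>V. d u v * x \<mu> v) = \<mu> * x \<mu> u"
    by metis
  have orth: "(\<Sum>u\<in>V. x \<mu> u * x \<nu> u) = 0" if "\<mu> \<in> A" "\<nu> \<in> A" "\<mu> \<noteq> \<nu>" for \<mu> \<nu>
  proof -
    have "\<mu> * (\<Sum>u\<in>V. x \<mu> u * x \<nu> u) = (\<Sum>u\<in>V. (\<mu> * x \<mu> u) * x \<nu> u)"
      by (simp add: sum_distrib_left algebra_simps)
    also have "\<dots> = (\<Sum>u\<in>V. \<Sum>v\<in>V. d u v * x \<mu> v * x \<nu> u)"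
      by (intro sum.cong) (auto simp: x(2)[OF that(1), symmetric] sum_distrib_right)
    also have "\<dots> = (\<Sum>v\<in>V. \<Sum>u\<in>V. d u v * x \<mu> v * x \<nu> u)"
      by (rule sum.swap)
    also have "\<dots> = (\<Sum>v\<in>V. x \<mu> v * (\<Sum>u\<in>V. d v u * x \<nu> u))"
      unfolding sum_distrib_left by (intro sum.cong refl) (auto simp: sym)
    also have "\<dots> = (\<Sum>v\<in>V. x \<mu> v * (\<nu> * x \<nu> v))"
      by (intro sum.cong) (auto simp: x(2)[OF that(2)])
    also have "\<dots> = \<nu> * (\<Sum>u\<in>V. x \<mu> u * x \<nu> u)"
      by (simp add: sum_distrib_left algebra_simps)
    finally show ?thesis using that(3) by simp
  qed
  define e where "e \<mu> v = x \<mu> v / sqrt (sqnorm_on V (x \<mu>))" for \<mu> v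
  have "(\<Sum>v\<in>V. e i v * e j v) = (if i = j then 1 else 0)" if "i \<in> A" "j \<in> A" for i j
  proof -
    have *: "(\<Sum>v\<in>V. e i v * e j v)
        = (\<Sum>v\<in>V. x i v * x j v) / (sqrt (sqnorm_on V (x i)) * sqrt (sqnorm_on V (x j)))"
      unfolding e_def by (simp add: sum_divide_distrib)
    have "sqnorm_on V (x i) > 0"
      using sqnorm_on_pos[OF assms(1)] x(1)[OF that(1)] by blast
    then have "(\<Sum>v\<in>V. x i v * x i v) / (sqrt (sqnorm_on V (x i)) * sqrt (sqnorm_on V (x i))) = 1"
      by (simp add: sqnorm_on_def power2_eq_square)
    then show ?thesis using * orth[OF that] by auto
  qed
  then have "card A \<le> card V"
    by (intro card_orthonormal_le[OF assms(1) A(2)])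
  then show False using A(3) by simp
qed

text \<open>Perron's comparison: at the vertex \<open>w\<close> where the ratio of the absolute
  value of \<open>x\<close> to \<open>y\<close> is largest, the triangle inequality in the equation
  for \<open>x\<close> and the equation for \<open>y\<close> give the bound. A positive eigenvector
  thus belongs to the largest eigenvalue.\<close>

lemma eigenvalue_le_of_positive_eigenvector:
  fixes V :: "'a set" and d :: "'a \<Rightarrow> 'a \<Rightarrow> real"
  assumes "finite V" and nonneg: "\<And>u v. u \<in> V \<Longrightarrow> v \<in> V \<Longrightarrow> d u v \<ge> 0"
    and ypos: "\<And>v. v \<in> V \<Longrightarrow> y v > 0"
    and y: "\<And>u. u \<in> V \<Longrightarrow> (\<Sum>v\<in>V. d u v * y v) = \<mu> * y u"
    and x: "\<exists>v\<in>V. x v \<noteq> 0" "\<And>u. u \<in> V \<Longrightarrow> (\<Sum>v\<in>V. d u v * x v) = \<nu> * x u"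
  shows "\<nu> \<le> \<mu>"
proof -
  define r where "r v = \<bar>x v\<bar> / y v" for v
  have "V \<noteq> {}" using x(1) by auto
  then have "Max (r ` V) \<in> r ` V"
    using assms(1) by (intro Max_in) auto
  then obtain w where "w \<in> V" "r w = Max (r ` V)"
    by auto
  then have w: "w \<in> V" "\<And>v. v \<in> V \<Longrightarrow> r v \<le> r w"
    using assms(1) by auto
  have rpos: "r w > 0"
  proof -
    obtain v where "v \<in> V" "x v \<noteq> 0" using x(1) by auto
    then have "r v > 0" using ypos by (simp add: r_def)
    then show ?thesis using w(2)[OF \<open>v \<in> V\<close>] by linarith
  qed
  have xw: "\<bar>x w\<bar> = r w * y w" using ypos[OF w(1)] by (simp add: r_def)
  have "\<nu> * \<bar>x w\<bar> \<le> \<bar>\<nu> * x w\<bar>" by (simp add: abs_mult mult_right_mono)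
  also have "\<dots> = \<bar>\<Sum>v\<in>V. d w v * x v\<bar>" using x(2)[OF w(1)] by simp
  also have "\<dots> \<le> (\<Sum>v\<in>V. \<bar>d w v * x v\<bar>)" by (rule sum_abs)
  also have "\<dots> \<le> (\<Sum>v\<in>V. d w v * (r w * y v))"
  proof (rule sum_mono)
    fix v assume v: "v \<in> V"
    have "\<bar>x v\<bar> = r v * y v" using ypos[OF v] by (simp add: r_def)
    also have "\<dots> \<le> r w * y v" using w(2)[OF v] ypos[OF v] by (simp add: mult_right_mono)
    finally show "\<bar>d w v * x v\<bar> \<le> d w v * (r w * y v)"
      using nonneg[OF w(1) v] by (simp add: abs_mult mult_left_mono)
  qed
  also have "\<dots> = r w * (\<Sum>v\<in>V. d w v * y v)"
    unfolding sum_distrib_left by (intro sum.cong) auto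
  also have "\<dots> = \<mu> * \<bar>x w\<bar>" using y[OF w(1)] xw by simp
  finally show ?thesis
    using rpos xw ypos[OF w(1)] by (simp add: mult_le_cancel_right)
qed

section \<open>Perfect matchings and Tutte's obstruction\<close>

text \<open>A perfect matching of \<open>V\<close>, encoded as a fixed-point-free involution along
  edges. Since \<open>E\<close> may reach outside \<open>V\<close>, matchings of disjoint parts
  share one edge set and are glued by a case distinction.\<close>

definition pairing :: "'a set \<Rightarrow> 'a set set \<Rightarrow> ('a \<Rightarrow> 'a) \<Rightarrow> bool" where
  "pairing V E p \<longleftrightarrow> (\<forall>v\<in>V. p v \<in> V \<and> p v \<noteq> v \<and> p (p v) = v \<and> {v, p v} \<in> E)"

lemma perfect_k_matching_of_pairing:
  assumes "simple_graph V E" "pairing V E p"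
  shows "has_perfect_k_matching V E k"
proof -
  have fin: "finite E"
  proof -
    have "E \<subseteq> Pow V" using assms(1) unfolding simple_graph_def by fastforce
    then show ?thesis using assms(1) unfolding simple_graph_def by (meson finite_Pow_iff finite_subset)
  qed
  define f where "f e = (if \<exists>v\<in>V. e = {v, p v} then k else 0)" for e
  have "(\<Sum>e\<in>incident_edges E v. f e) = k" if v: "v \<in> V" for v
  proof -
    have "(\<Sum>e\<in>incident_edges E v. f e) = (\<Sum>e\<in>incident_edges E v. if e = {v, p v} then k else 0)"
    proof (rule sum.cong[OF refl])
      fix e assume e: "e \<in> incident_edges E v"
      have "e = {v, p v}" if "w \<in> V" "e = {w, p w}" for w
      proof -
        have "v = w \<or> v = p w" using e that(2) by (auto simp: incident_edges_def)
        then show ?thesis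
        proof
          assume "v = p w"
          moreover have "p (p w) = w" using assms(2) that(1) by (simp add: pairing_def)
          ultimately show ?thesis using that(2) by (simp add: insert_commute)
        qed (use that(2) in simp)
      qed
      then have "(\<exists>w\<in>V. e = {w, p w}) \<longleftrightarrow> e = {v, p v}"
        using v by blast
      then show "f e = (if e = {v, p v} then k else 0)"
        by (simp add: f_def)
    qed
    also have "\<dots> = k"
    proof -
      have "finite (incident_edges E v)" using fin by (simp add: incident_edges_def)
      moreover have "{v, p v} \<in> incident_edges E v"
        using v assms(2) by (simp add: incident_edges_def pairing_def)
      ultimately show ?thesis by simp
    qed
    finally show ?thesis .
  qed
  then have "perfect_k_matching V E k f"
    unfolding perfect_k_matching_def k_matching_def by (auto simp: f_def)
  then show ?thesis unfolding has_perfect_k_matching_def by blast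
qed

section \<open>Gluing and exchanging perfect matchings of parts of the vertex set\<close>

lemma pairing_Un:
  assumes "pairing A E p" "pairing B E q" "A \<inter> B = {}"
  shows "pairing (A \<union> B) E (\<lambda>v. if v \<in> A then p v else q v)"
  using assms unfolding pairing_def by auto

lemma pairing_Union:
  assumes "finite F" "disjoint F" "\<And>A. A \<in> F \<Longrightarrow> \<exists>p. pairing A E p"
  shows "\<exists>p. pairing (\<Union>F) E p"
  using assms
proof (induction F rule: finite_induct)
  case empty
  then show ?case by (simp add: pairing_def)
next
  case (insert A F)
  then have "disjoint F" by (auto simp: pairwise_insert)
  then obtain p where p: "pairing (\<Union>F) E p" using insert by auto
  obtain q where q: "pairing A E q" using insert by auto
  have "A \<inter> \<Union>F = {}"
    using insert.prems(1) insert.hyps(2) by (auto simp: pairwise_insert disjnt_def)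
  then show ?case using pairing_Un[OF q p] by auto
qed

lemma pairing_clique:
  assumes "finite A" "even (card A)" "\<And>u v. u \<in> A \<Longrightarrow> v \<in> A \<Longrightarrow> u \<noteq> v \<Longrightarrow> {u, v} \<in> E"
  shows "\<exists>p. pairing A E p"
  using assms
proof (induction "card A" arbitrary: A rule: less_induct)
  case less
  show ?case
  proof (cases "A = {}")
    case True
    then have "pairing A E id" by (simp add: pairing_def)
    then show ?thesis by blast
  next
    case False
    then obtain u where u: "u \<in> A" by auto
    then have "A \<noteq> {u}" using less.prems(2) by auto
    then obtain v where v: "v \<in> A" "v \<noteq> u" using u by auto
    let ?B = "A - {u, v}"
    have card: "card A = Suc (Suc (card ?B))"
      using u v less.prems(1) 
      by (metis Diff_insert card_Suc_Diff1 finite_Diff insertE insert_Diff)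
    then obtain p where p: "pairing ?B E p"
      using less.hyps[of ?B] less.prems by auto
    have "pairing {u, v} E (\<lambda>w. if w = u then v else u)"
      using u v less.prems(3) by (auto simp: pairing_def insert_commute)
    from pairing_Un[OF this p] have "\<exists>p. pairing ({u, v} \<union> ?B) E p" by blast
    moreover have "{u, v} \<union> ?B = A" using u v by auto
    ultimately show ?thesis by simp
  qed
qed

text \<open>A set closed under both involutions is a union of cycles alternating between the two
  matchings, so \<open>p\<close> may be used on it and \<open>q\<close> off it.\<close>

lemma pairing_swap:
  assumes p: "pairing V E1 p" and q: "pairing V E2 q"
    and XV: "X \<subseteq> V" and clp: "p ` X \<subseteq> X" and clq: "q ` X \<subseteq> X"
    and "\<And>v. v \<in> X \<Longrightarrow> {v, p v} \<in> E" "\<And>v. v \<in> V - X \<Longrightarrow> {v, q v} \<in> E"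
  shows "pairing V E (\<lambda>v. if v \<in> X then p v else q v)"
proof -
  have "pairing X E p"
    using assms unfolding pairing_def by auto
  moreover have "pairing (V - X) E q"
  proof -
    have "q v \<notin> X" if "v \<in> V - X" for v
    proof
      assume "q v \<in> X"
      then have "q (q v) \<in> X" using clq by auto
      then show False using that q by (auto simp: pairing_def)
    qed
    then show ?thesis using assms(7) q unfolding pairing_def by auto
  qed
  ultimately have "pairing (X \<union> (V - X)) E (\<lambda>v. if v \<in> X then p v else q v)"
    by (intro pairing_Un) auto
  moreover have "X \<union> (V - X) = V" using XV by auto
  ultimately show ?thesis by simp
qed

text \<open>Even and odd positions of the alternating walk never coincide. A coincidence for
  \<open>w\<close> and \<open>j\<close> can be peeled at both ends to one for \<open>q (p w)\<close>
  and \<open>j - 2\<close>, and in the end \<open>p\<close> or \<open>q\<close> would have a fixed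
  point.\<close>

lemma alternating_walk_bipartite:
  assumes p: "pairing V E1 p" and q: "pairing V E2 q" and "w \<in> V"
  shows "((\<lambda>v. q (p v)) ^^ j) w \<noteq> p w"
  using assms(3)
proof (induction j arbitrary: w rule: less_induct)
  case (less j)
  have mem: "((\<lambda>v. q (p v)) ^^ i) w \<in> V" for i
    using less.prems p q by (induction i) (auto simp: pairing_def)
  show ?case
  proof
    assume eq: "((\<lambda>v. q (p v)) ^^ j) w = p w"
    consider "j = 0" | "j = 1" | i where "j = Suc (Suc i)"
      by (metis One_nat_def not0_implies_Suc)
    then show False
    proof cases
      case 1
      then show False using eq less.prems p by (auto simp: pairing_def)
    next
      case 2
      then show False using eq less.prems p q by (auto simp: pairing_def)
    next
      case 3
      let ?g = "\<lambda>v. q (p v)"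
      have i: "(?g ^^ Suc i) w \<in> V" by (rule mem)
      have "q (p ((?g ^^ Suc i) w)) = p w" using eq 3 by simp
      then have "p ((?g ^^ Suc i) w) = q (p w)"
        using i p q unfolding pairing_def by metis
      then have "(?g ^^ Suc i) w = p (q (p w))"
        using i p unfolding pairing_def by metis
      then have "(?g ^^ i) (q (p w)) = p (q (p w))"
        by (simp only: funpow_Suc_right o_def)
      moreover have "q (p w) \<in> V" using less.prems p q by (auto simp: pairing_def)
      ultimately show False using less.IH[of i "q (p w)"] 3 by auto
    qed
  qed
qed

text \<open>The exchange step of Lovasz's proof of Tutte's theorem. The alternating walk that starts at
  \<open>d\<close> with an edge of \<open>p\<close> either misses \<open>{a, c}\<close>, and then the two pairings are switched along it,
  or it first meets \<open>{a, c}\<close> at some \<open>z\<close> after an edge of \<open>q\<close>, and then it is closed up by \<open>{z, b}\<close>.\<close>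

lemma pairing_exchange:
  assumes "finite V" and p: "pairing V (insert {a, c} E) p" and q: "pairing V (insert {b, d} E) q"
    and ab: "{a, b} \<in> E" and bc: "{b, c} \<in> E" and bd: "b \<noteq> d" "{b, d} \<notin> E"
    and V: "a \<in> V" "b \<in> V" "c \<in> V" "d \<in> V" and neq: "a \<noteq> b" "b \<noteq> c"
  shows "\<exists>r. pairing V E r"
proof (cases "pairing V E p \<or> pairing V E q")
  case True
  then show ?thesis by blast
next
  case False
  define g where "g v = q (p v)" for v
  have pa: "p a = c" "p c = a"
    using False p unfolding pairing_def by (auto simp: doubleton_eq_iff)
  have qb: "q b = d" "q d = b"
    using False q unfolding pairing_def by (auto simp: doubleton_eq_iff)
  have pV: "p v \<in> V" "p v \<noteq> v" "p (p v) = v" if "v \<in> V" for v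
    using p that by (auto simp: pairing_def)
  have qV: "q v \<in> V" "q v \<noteq> v" "q (q v) = v" if "v \<in> V" for v
    using q that by (auto simp: pairing_def)
  have d: "d \<noteq> a" "d \<noteq> c"
    using bd(2) ab bc by (auto simp: insert_commute)
  have pE: "{v, p v} \<in> E" if "v \<in> V" "v \<noteq> a" "v \<noteq> c" for v
    using p that by (fastforce simp: pairing_def doubleton_eq_iff)
  have qE: "{v, q v} \<in> E" if "v \<in> V" "v \<noteq> b" "v \<noteq> d" for v
    using q that by (fastforce simp: pairing_def doubleton_eq_iff)
  have gV: "(g ^^ i) d \<in> V" for i
    using V pV qV by (induction i) (auto simp: g_def)
  show ?thesis
  proof (cases "\<exists>i. (g ^^ i) d \<in> {a, c}")
    case False
    \<comment> \<open>These are the even positions of the walk. By finiteness \<open>g\<close>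
      permutes them, so adding their \<open>p\<close>-partners gives a set closed under
      \<open>q\<close> as well. It avoids \<open>a\<close> and \<open>c\<close> and contains
      \<open>d\<close> and \<open>b = q d\<close>, so switching uses neither of the two extra
      edges.\<close>
    define A where "A = range (\<lambda>i. (g ^^ i) d)"
    have AV: "A \<subseteq> V" using gV by (auto simp: A_def)
    have gA: "g ` A \<subseteq> A"
    proof -
      have "g ((g ^^ i) d) = (g ^^ Suc i) d" for i by simp
      then show ?thesis unfolding A_def by blast
    qed
    have "inj_on g A"
      using AV pV qV unfolding inj_on_def g_def by (metis subsetD)
    then have gsurj: "g ` A = A"
      using gA AV assms(1) by (meson endo_inj_surj finite_subset)
    have dA: "d \<in> A" unfolding A_def by (metis funpow_0 rangeI)
    let ?X = "A \<union> p ` A"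
    have "pairing V E (\<lambda>v. if v \<in> ?X then p v else q v)"
    proof (rule pairing_swap[OF p q])
      show "?X \<subseteq> V" using AV pV by auto
      show "p ` ?X \<subseteq> ?X" using AV pV by auto
      show "q ` ?X \<subseteq> ?X"
      proof -
        have "q (p y) \<in> A" if "y \<in> A" for y using gA that by (auto simp: g_def)
        moreover have "q y \<in> p ` A" if y: "y \<in> A" for y
        proof -
          obtain y' where y': "y' \<in> A" "y = q (p y')" using gsurj y by (auto simp: g_def)
          then have "q y = p y'" using qV pV AV by auto
          then show ?thesis using y' by auto
        qed
        ultimately show ?thesis by auto
      qed
      have A: "y \<noteq> a" "y \<noteq> c" if "y \<in> A" for y
        using False that unfolding A_def by auto
      then have "p y \<noteq> a \<and> p y \<noteq> c" if "y \<in> A" for y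
        using pV(3) pa AV that by (metis subsetD)
      then show "{v, p v} \<in> E" if "v \<in> ?X" for v
        using that A AV pV(1) by (intro pE) auto
      have "q d \<in> ?X" using \<open>q ` ?X \<subseteq> ?X\<close> dA by blast
      then have "b \<in> ?X" by (simp add: qb)
      then show "{v, q v} \<in> E" if "v \<in> V - ?X" for v
        using that dA by (intro qE) auto
    qed
    then show ?thesis by blast
  next
    case True
    define k where "k = (LEAST i. (g ^^ i) d \<in> {a, c})"
    define z where "z = (g ^^ k) d"
    have z: "z \<in> {a, c}" unfolding z_def k_def using True by (rule LeastI_ex)
    have min: "(g ^^ i) d \<notin> {a, c}" if "i < k" for i
      using not_less_Least that unfolding k_def by blast
    have k0: "k > 0" using z d unfolding z_def by (cases k) auto
    define A where "A = (\<lambda>i. (g ^^ i) d) ` {..<k}"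
    define X where "X = A \<union> p ` A"
    have AV: "A \<subseteq> V" using gV by (auto simp: A_def)
    have zV: "z \<in> V" using z V by auto
    have dA: "d \<in> A" unfolding A_def using k0 by (metis funpow_0 imageI lessThan_iff)
    have A: "y \<noteq> a" "y \<noteq> c" if "y \<in> A" for y
      using min that unfolding A_def by auto
    \<comment> \<open>Since \<open>p\<close> swaps \<open>a\<close> and \<open>c\<close>, an odd
      position \<open>p y\<close> can be one of them only if \<open>y\<close> already is. Hence the
      first visit to \<open>{a, c}\<close> occurs at an even position.\<close>
    have pA: "p y \<noteq> a" "p y \<noteq> c" if "y \<in> A" for y
      using pV(3) pa AV A that by (metis subsetD)+
    have zX: "z \<notin> X"
      using z A pA unfolding X_def by auto
    \<comment> \<open>If \<open>b = q d\<close> were an even position, \<open>p d\<close> would be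
      one too, contrary to \<open>alternating_walk_bipartite\<close>. If \<open>b\<close> were an
      odd position, the walk would return to \<open>d\<close> before \<open>z\<close>, so
      \<open>z\<close> would occur again at an index below \<open>k\<close>.\<close>
    have bX: "b \<notin> X"
    proof
      assume "b \<in> X"
      then consider i where "i < k" "b = (g ^^ i) d" | i where "i < k" "b = p ((g ^^ i) d)"
        unfolding X_def A_def by auto
      then show False
      proof cases
        case 1
        then obtain j where j: "i = Suc j" using bd(1) by (cases i) auto
        then have "b = q (p ((g ^^ j) d))" using 1 by (simp add: g_def)
        then have "d = p ((g ^^ j) d)" using qb(1) qV pV gV by metis
        then have "(g ^^ j) d = p d" using pV gV by metis
        then show False
          using alternating_walk_bipartite[OF p q V(4)] unfolding g_def by blast
      next
        case 2
        then have per: "(g ^^ Suc i) d = d" using qb(1) by (simp add: g_def)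
        have "z = (g ^^ (k - Suc i)) ((g ^^ Suc i) d)"
          unfolding z_def using 2(1)
          by (metis Suc_leI comp_apply funpow_add le_add_diff_inverse2)
        then show False using z per min[of "k - Suc i"] k0 by auto
      qed
    qed
    let ?p = "\<lambda>v. if v \<in> X then p v else if v = b then z else b"
    let ?Y = "X \<union> {b, z}"
    have zb: "z \<noteq> b" "{z, b} \<in> E" using z neq ab bc by (auto simp: insert_commute)
    have clp: "p ` X \<subseteq> X" unfolding X_def using AV pV by auto
    have pE': "{v, p v} \<in> E" if "v \<in> X" for v
      using that A pA AV pV(1) by (intro pE) (auto simp: X_def)
    have XV: "X \<subseteq> V" using AV pV by (auto simp: X_def)
    have p': "pairing ?Y E ?p"
    proof -
      have "pairing X E p" using clp pE' XV pV by (auto simp: pairing_def)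
      moreover have "pairing {b, z} E (\<lambda>v. if v = b then z else b)"
        using zb by (auto simp: pairing_def insert_commute)
      ultimately show ?thesis
        using bX zX by (intro pairing_Un) auto
    qed
    have clq: "q ` ?Y \<subseteq> ?Y"
    proof -
      have "q (p y) \<in> A \<union> {z}" if "y \<in> A" for y
      proof -
        obtain i where i: "i < k" "y = (g ^^ i) d" using \<open>y \<in> A\<close> unfolding A_def by auto
        then have *: "q (p y) = (g ^^ Suc i) d" by (simp add: g_def)
        show ?thesis
        proof (cases "Suc i = k")
          case True
          then show ?thesis using * unfolding z_def by auto
        next
          case False
          then have "Suc i < k" using i by simp
          then show ?thesis using * unfolding A_def by blast
        qed
      qed
      moreover have prev: "q ((g ^^ Suc i) d) \<in> X" if "i < k" for i
      proof -
        have "q ((g ^^ Suc i) d) = p ((g ^^ i) d)"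
          using gV pV qV by (simp add: g_def)
        then show ?thesis using that unfolding X_def A_def by auto
      qed
      have "q y \<in> ?Y" if "y \<in> A" for y
      proof -
        obtain i where i: "i < k" "y = (g ^^ i) d" using \<open>y \<in> A\<close> unfolding A_def by auto
        show ?thesis
        proof (cases i)
          case 0
          then show ?thesis using i qb by auto
        next
          case (Suc j)
          then show ?thesis using i prev[of j] by auto
        qed
      qed
      moreover have "q z \<in> X"
        using prev[of "k - 1"] k0 unfolding z_def by auto
      moreover have "q b \<in> X" using qb dA by (auto simp: X_def)
      ultimately show ?thesis by (auto simp: X_def)
    qed
    have "pairing (V - ?Y) E q"
    proof -
      have "q v \<notin> ?Y" if "v \<in> V - ?Y" for v
      proof
        assume "q v \<in> ?Y"
        then have "q (q v) \<in> ?Y" using clq by blast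
        then show False using that qV(3)[of v] by auto
      qed
      moreover have "{v, q v} \<in> E" if "v \<in> V - ?Y" for v
        using that dA by (intro qE) (auto simp: X_def)
      ultimately show ?thesis using qV unfolding pairing_def by auto
    qed
    from pairing_Un[OF p' this] have "\<exists>r. pairing (?Y \<union> (V - ?Y)) E r" by blast
    moreover have "?Y \<union> (V - ?Y) = V" using XV V zV by auto
    ultimately show ?thesis by simp
  qed
qed

text \<open>Lovasz's proof: in an edge-maximal supergraph without a perfect matching, the vertices
  that are not adjacent to everything fall into disjoint cliques. With at most \<open>card S\<close>
  odd cliques a perfect matching could be assembled, and parity turns an excess of one into two. The
  classes are recorded as a labelling \<open>cl\<close> that is constant along edges outside
  \<open>S\<close>, so no component of \<open>G\<close> has to be formed.\<close>

lemma tutte_obstruction: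
  fixes V :: "'a set"
  assumes "simple_graph V E" "even (card V)" "\<nexists>p. pairing V E p"
  obtains S and cl :: "'a \<Rightarrow> 'a set" where "S \<subseteq> V" "card S + 2 \<le> card (cl ` (V - S))"
    and "\<And>u v. u \<in> V - S \<Longrightarrow> v \<in> V - S \<Longrightarrow> {u, v} \<in> E \<Longrightarrow> cl u = cl v"
proof -
  have fV: "finite V" using assms(1) by (simp add: simple_graph_def)
  define K where "K = {{u, v} | u v. u \<in> V \<and> v \<in> V \<and> u \<noteq> v}"
  define \<T> where "\<T> = {E'. E' \<subseteq> K \<and> (\<nexists>p. pairing V E' p)}"
  have "K \<subseteq> Pow V" by (auto simp: K_def)
  then have "finite K" using fV by (meson finite_Pow_iff finite_subset)
  then have "finite \<T>" by (simp add: \<T>_def)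
  moreover have "E \<subseteq> K"
  proof
    fix e assume "e \<in> E"
    then show "e \<in> K" using assms(1) unfolding simple_graph_def K_def by blast
  qed
  then have "E \<in> \<T>" using assms(3) by (simp add: \<T>_def)
  ultimately obtain E' where E': "E' \<in> \<T>" "E \<subseteq> E'" "\<And>E''. E'' \<in> \<T> \<Longrightarrow> E' \<subseteq> E'' \<Longrightarrow> E' = E''"
    using finite_has_maximal2[of \<T> E] by metis
  have noE': "\<not> pairing V E' p" for p using E'(1) by (auto simp: \<T>_def)
  have maxE': "\<exists>p. pairing V (insert {u, v} E') p"
    if "u \<in> V" "v \<in> V" "u \<noteq> v" "{u, v} \<notin> E'" for u v
  proof (rule ccontr)
    assume "\<not> ?thesis"
    then have "insert {u, v} E' \<in> \<T>" using E'(1) that by (auto simp: \<T>_def K_def)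
    then show False using E'(3)[of "insert {u, v} E'"] that by auto
  qed
  define S where "S = {v \<in> V. \<forall>u\<in>V. u \<noteq> v \<longrightarrow> {u, v} \<in> E'}"
  define cl where "cl u = {v \<in> V - S. u = v \<or> {u, v} \<in> E'}" for u
  \<comment> \<open>If \<open>{a, c}\<close> were missing, \<open>b\<close> would have a
    non-neighbour \<open>d\<close> since it is outside \<open>S\<close>. By maximality adding
    \<open>{a, c}\<close> and adding \<open>{b, d}\<close> each creates a perfect matching, and
    \<open>pairing_exchange\<close> turns the two into one of \<open>E'\<close>.\<close>
  have trans: "{a, c} \<in> E'" if abc: "a \<in> V" "b \<in> V - S" "c \<in> V" "a \<noteq> b" "b \<noteq> c" "a \<noteq> c"
    "{a, b} \<in> E'" "{b, c} \<in> E'" for a b c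
  proof (rule ccontr)
    assume ac: "{a, c} \<notin> E'"
    obtain d where d: "d \<in> V" "b \<noteq> d" "{b, d} \<notin> E'"
      using abc(2) by (auto simp: S_def insert_commute)
    obtain p where p: "pairing V (insert {a, c} E') p" using maxE' ac abc by blast
    obtain q where q: "pairing V (insert {b, d} E') q" using maxE' d abc by blast
    have "\<exists>r. pairing V E' r"
      using d abc by (intro pairing_exchange[OF fV p q]) auto
    then show False using noE' by blast
  qed
  have cleq: "cl u = cl v" if "u \<in> V - S" "v \<in> V - S" "{u, v} \<in> E'" for u v
  proof (cases "u = v")
    case False
    have uv: "{v, u} \<in> E'" using that(3) by (simp add: insert_commute)
    have "{v, w} \<in> E'" if "w \<in> V - S" "{u, w} \<in> E'" "v \<noteq> w" "u \<noteq> w" for w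
      using trans[of v u w] that uv \<open>u \<in> V - S\<close> \<open>v \<in> V - S\<close> False by auto
    moreover have "{u, w} \<in> E'" if "w \<in> V - S" "{v, w} \<in> E'" "v \<noteq> w" "u \<noteq> w" for w
      using trans[of u v w] that \<open>{u, v} \<in> E'\<close> \<open>u \<in> V - S\<close> \<open>v \<in> V - S\<close> False by auto
    ultimately show ?thesis
      using uv that unfolding cl_def by fastforce
  qed simp
  have clself: "u \<in> cl u" if "u \<in> V - S" for u using that by (simp add: cl_def)
  have clmem: "cl v = cl u" if "u \<in> V - S" "v \<in> cl u" for u v
    using that cleq[of u v] by (auto simp: cl_def)
  define F where "F = cl ` (V - S)"
  have clF: "cl v = C" if "C \<in> F" "v \<in> C" for C v
    using that clmem by (auto simp: F_def)
  have FV: "C \<subseteq> V - S" if "C \<in> F" for C using that by (auto simp: F_def cl_def)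
  have UF: "\<Union>F = V - S" using FV clself by (fastforce simp: F_def)
  have disF: "disjoint F"
    using clF unfolding pairwise_def disjnt_def by blast
  have finF: "finite F" using fV by (simp add: F_def)
  have finC: "finite C" if "C \<in> F" for C using FV[OF that] fV by (meson finite_Diff finite_subset)
  have clique: "{u, v} \<in> E'" if "C \<in> F" "u \<in> C" "v \<in> C" "u \<noteq> v" for C u v
  proof -
    have "v \<in> cl u" using that clF[OF that(1,2)] by simp
    then show ?thesis using that(4) by (simp add: cl_def)
  qed
  have SV: "S \<subseteq> V" by (auto simp: S_def)
  have fS: "finite S" using fV SV finite_subset by blast
  have univ: "{u, v} \<in> E'" if "u \<in> V" "v \<in> S" "u \<noteq> v" for u v using that by (simp add: S_def)
  define Odd where "Odd = {C \<in> F. odd (card C)}"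
  have "card V = card S + card (\<Union>F)"
    unfolding UF using fV SV fS by (metis card_Diff_subset card_mono le_add_diff_inverse)
  also have "card (\<Union>F) = sum card F"
    using disF finC by (intro card_Union_disjoint) auto
  finally have parity: "even (card S + card Odd)"
    using assms(2) even_sum_iff[OF finF, of card] by (simp add: Odd_def)
  have "card Odd > card S"
  proof (rule ccontr)
    assume "\<not> card Odd > card S"
    then obtain h where h: "h ` Odd \<subseteq> S" "inj_on h Odd"
      using card_le_inj[of Odd S] finF fS by (auto simp: Odd_def)
    have hF: "h D \<notin> C" if "D \<in> Odd" "C \<in> F" for C D
      using h(1) FV[OF that(2)] that(1) by auto
    \<comment> \<open>Each odd clique borrows a universal vertex \<open>h C\<close> of its own and
      becomes an even clique. The universal vertices left over form a clique whose size is even by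
      \<open>parity\<close>.\<close>
    define big where "big C = (if C \<in> Odd then insert (h C) C else C)" for C
    have "\<exists>p. pairing (\<Union>(big ` F)) E' p"
    proof (rule pairing_Union)
      show "finite (big ` F)" using finF by simp
      have "big C \<inter> big C' = {}" if "C \<in> F" "C' \<in> F" "C \<noteq> C'" for C C'
      proof -
        have "C \<inter> C' = {}" using disF that by (auto simp: pairwise_def disjnt_def)
        moreover have "h C \<noteq> h C'" if "C \<in> Odd" "C' \<in> Odd"
          using h(2) \<open>C \<noteq> C'\<close> that by (auto dest: inj_onD)
        ultimately show ?thesis
          using hF that unfolding big_def by auto
      qed
      then show "disjoint (big ` F)"
        unfolding pairwise_def disjnt_def by blast
      fix A assume "A \<in> big ` F"
      then obtain C where C: "C \<in> F" "A = big C" by auto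
      show "\<exists>p. pairing A E' p"
      proof (rule pairing_clique)
        show "finite A" using finC[OF C(1)] C(2) by (simp add: big_def)
        show "even (card A)"
          using C finC[OF C(1)] hF[of C C] by (auto simp: big_def Odd_def)
        have "h C \<in> S" if "C \<in> Odd" using h(1) that by auto
        then show "{u, v} \<in> E'" if "u \<in> A" "v \<in> A" "u \<noteq> v" for u v
          using that C FV[OF C(1)] clique[OF C(1)] univ[of u v] univ[of v u]
          by (auto simp: big_def insert_commute split: if_splits)
      qed
    qed
    then obtain p where p: "pairing (\<Union>(big ` F)) E' p" by blast
    have "\<exists>q. pairing (S - h ` Odd) E' q"
    proof (rule pairing_clique)
      have "card (S - h ` Odd) = card S - card Odd"
        using h finF by (simp add: card_Diff_subset card_image Odd_def)
      then show "even (card (S - h ` Odd))"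
        using parity \<open>\<not> card Odd > card S\<close> by simp
    qed (use fS univ SV in auto)
    then obtain q where q: "pairing (S - h ` Odd) E' q" by blast
    have "\<Union>(big ` F) = h ` Odd \<union> (V - S)"
      unfolding UF[symmetric] big_def by (auto simp: Odd_def split: if_splits)
    then have "\<Union>(big ` F) \<inter> (S - h ` Odd) = {}" "\<Union>(big ` F) \<union> (S - h ` Odd) = V"
      using h(1) SV by auto
    then have "\<exists>r. pairing V E' r"
      using pairing_Un[OF p q] by auto
    then show False using noE' by blast
  qed
  then have "card S + 2 \<le> card Odd" using parity by presburger
  also have "card Odd \<le> card (cl ` (V - S))"
    using finF unfolding Odd_def F_def by (intro card_mono) auto
  finally show ?thesis
    using that[of S cl] SV cleq E'(2) by blast
qed

section \<open>Distances and the distance spectral radius\<close>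

lemma is_walk_rev: "is_walk V E xs \<Longrightarrow> is_walk V E (rev xs)"
  unfolding is_walk_def
proof (intro conjI allI impI)
  assume w: "xs \<noteq> [] \<and> set xs \<subseteq> V \<and> (\<forall>i. Suc i < length xs \<longrightarrow> {xs ! i, xs ! Suc i} \<in> E)"
  show "rev xs \<noteq> []" "set (rev xs) \<subseteq> V" using w by auto
  fix i assume i: "Suc i < length (rev xs)"
  let ?j = "length xs - Suc (Suc i)"
  have "{xs ! ?j, xs ! Suc ?j} \<in> E" using w i by simp
  moreover have "rev xs ! i = xs ! Suc ?j" "rev xs ! Suc i = xs ! ?j"
    using i by (auto simp: rev_nth Suc_diff_Suc)
  ultimately show "{rev xs ! i, rev xs ! Suc i} \<in> E" by (simp add: insert_commute)
qed

lemma gdist_le: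
  "is_walk V E xs \<Longrightarrow> hd xs = u \<Longrightarrow> last xs = v \<Longrightarrow> length xs = Suc m \<Longrightarrow> gdist V E u v \<le> m"
  unfolding gdist_def by (rule Least_le) blast

lemma gdist_walk:
  assumes "connected_graph V E" "u \<in> V" "v \<in> V"
  obtains xs where "is_walk V E xs" "hd xs = u" "last xs = v" "length xs = Suc (gdist V E u v)"
proof -
  obtain xs where "is_walk V E xs" "hd xs = u" "last xs = v"
    using assms unfolding connected_graph_def by blast
  moreover from this have "length xs = Suc (length xs - 1)"
    by (auto simp: is_walk_def)
  ultimately have "\<exists>m xs. is_walk V E xs \<and> hd xs = u \<and> last xs = v \<and> length xs = Suc m"
    by blast
  from LeastI_ex[OF this] show ?thesis
    using that unfolding gdist_def by blast
qed

lemma gdist_sym: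
  assumes "connected_graph V E" "u \<in> V" "v \<in> V"
  shows "gdist V E u v = gdist V E v u"
proof -
  have "gdist V E v u \<le> gdist V E u v" if uv: "u \<in> V" "v \<in> V" for u v
  proof -
    obtain xs where "is_walk V E xs" "hd xs = u" "last xs = v" "length xs = Suc (gdist V E u v)"
      using gdist_walk[OF assms(1) uv] .
    then show ?thesis
      by (intro gdist_le[of V E "rev xs"] is_walk_rev) (auto simp: hd_rev last_rev)
  qed
  then show ?thesis using assms(2,3) by (meson order_antisym)
qed

lemma gdist_self [simp]: "u \<in> V \<Longrightarrow> gdist V E u u = 0"
  using gdist_le[of V E "[u]" u u 0] by (simp add: is_walk_def)

lemma gdist_pos:
  assumes "connected_graph V E" "u \<in> V" "v \<in> V" "u \<noteq> v"
  shows "gdist V E u v \<ge> 1"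
proof (rule ccontr)
  assume "\<not> ?thesis"
  then have "gdist V E u v = 0" by simp
  then obtain xs where "hd xs = u" "last xs = v" "length xs = Suc 0"
    using gdist_walk[OF assms(1-3)] by metis
  then show False using assms(4) by (cases xs) auto
qed

lemma gdist_edge:
  assumes "u \<in> V" "v \<in> V" "{u, v} \<in> E"
  shows "gdist V E u v \<le> 1"
  using gdist_le[of V E "[u, v]" u v 1] assms by (simp add: is_walk_def)

lemma gdist_eq_1_iff:
  assumes "connected_graph V E" "u \<in> V" "v \<in> V" "u \<noteq> v"
  shows "gdist V E u v = 1 \<longleftrightarrow> {u, v} \<in> E"
proof
  assume "gdist V E u v = 1"
  then obtain xs where xs: "is_walk V E xs" "hd xs = u" "last xs = v" "length xs = Suc (Suc 0)"
    using gdist_walk[OF assms(1-3)] by (metis One_nat_def)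
  then obtain a b where "xs = [a, b]" by (auto simp: length_Suc_conv)
  then show "{u, v} \<in> E" using xs by (auto simp: is_walk_def)
next
  assume "{u, v} \<in> E"
  then show "gdist V E u v = 1" using gdist_edge gdist_pos assms by (metis order_antisym)
qed

lemma gdist_common_neighbour:
  assumes "u \<in> V" "v \<in> V" "w \<in> V" "{u, w} \<in> E" "{w, v} \<in> E"
  shows "gdist V E u v \<le> 2"
proof -
  have "is_walk V E [u, w, v]"
    using assms by (auto simp: is_walk_def less_Suc_eq)
  then show ?thesis using gdist_le[of V E "[u, w, v]" u v 2] by simp
qed

section \<open>Rayleigh and Perron bounds for the distance spectral radius\<close>

lemma dist_eigenvalues_finite:
  assumes "simple_graph V E" "connected_graph V E"
  shows "finite {\<mu>. dist_eigenvalue V E \<mu>}"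
  unfolding dist_eigenvalue_def
  using assms gdist_sym[OF assms(2)]
  by (intro finite_eigenvalues) (auto simp: simple_graph_def)

lemma bform_le_of_dist_spectral_radius_le:
  assumes "simple_graph V E" "connected_graph V E" and le: "dist_spectral_radius V E \<le> \<rho>"
  shows "bform_on V (\<lambda>u v. real (gdist V E u v)) z \<le> \<rho> * sqnorm_on V z"
proof -
  have V: "finite V" "V \<noteq> {}" using assms by (auto simp: simple_graph_def connected_graph_def)
  have sym: "real (gdist V E u v) = real (gdist V E v u)" if "u \<in> V" "v \<in> V" for u v
    using gdist_sym[OF assms(2) that] by simp
  obtain \<mu> x where mu: "\<exists>v\<in>V. x v \<noteq> 0"
    "\<And>u. u \<in> V \<Longrightarrow> (\<Sum>v\<in>V. real (gdist V E u v) * x v) = \<mu> * x u"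
    "\<And>z. bform_on V (\<lambda>u v. real (gdist V E u v)) z \<le> \<mu> * sqnorm_on V z"
    using exists_top_eigenpair[of V "\<lambda>u v. real (gdist V E u v)", OF V sym] by blast
  have "dist_eigenvalue V E \<mu>" unfolding dist_eigenvalue_def using mu(1,2) by blast
  then have "\<mu> \<le> dist_spectral_radius V E"
    unfolding dist_spectral_radius_def
    using dist_eigenvalues_finite[OF assms(1,2)] by (intro Max_ge) auto
  then have "\<mu> * sqnorm_on V z \<le> \<rho> * sqnorm_on V z"
    using le
    by (intro mult_right_mono) (auto simp: sqnorm_on_def sum_nonneg)
  then show ?thesis using mu(3)[of z] by linarith
qed

lemma dist_spectral_radius_le:
  assumes "simple_graph V E" "connected_graph V E"
    and "\<And>v. v \<in> V \<Longrightarrow> y v > 0"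
    and "\<And>u. u \<in> V \<Longrightarrow> (\<Sum>v\<in>V. real (gdist V E u v) * y v) = \<mu> * y u"
  shows "dist_spectral_radius V E \<le> \<mu>"
proof -
  have V: "finite V" "V \<noteq> {}" using assms by (auto simp: simple_graph_def connected_graph_def)
  have "real (gdist V E u v) = real (gdist V E v u)" if "u \<in> V" "v \<in> V" for u v
    using gdist_sym[OF assms(2) that] by simp
  with V obtain \<nu> x where "\<exists>v\<in>V. x v \<noteq> 0"
    "\<And>u. u \<in> V \<Longrightarrow> (\<Sum>v\<in>V. real (gdist V E u v) * x v) = \<nu> * x u"
    using exists_top_eigenpair[of V "\<lambda>u v. real (gdist V E u v)"] by metis
  then have "{\<mu>. dist_eigenvalue V E \<mu>} \<noteq> {}" unfolding dist_eigenvalue_def by blast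
  then have "dist_eigenvalue V E (dist_spectral_radius V E)"
    unfolding dist_spectral_radius_def
    using Max_in[OF dist_eigenvalues_finite[OF assms(1,2)]] by blast
  then obtain x where x: "\<exists>v\<in>V. x v \<noteq> 0"
    "\<And>u. u \<in> V \<Longrightarrow> (\<Sum>v\<in>V. real (gdist V E u v) * x v) = dist_spectral_radius V E * x u"
    unfolding dist_eigenvalue_def by blast
  show ?thesis
    by (rule eigenvalue_le_of_positive_eigenvector[where V = V and y = y and x = x
          and d = "\<lambda>u v. real (gdist V E u v)", OF V(1) of_nat_0_le_iff assms(3,4) x])
qed

section \<open>The graphs \<open>K\<^sub>s \<or> (K\<^sub>r \<union> i K\<^sub>1)\<close>\<close>

definition tripartition :: "'a set \<Rightarrow> 'a set \<Rightarrow> 'a set \<Rightarrow> 'a set \<Rightarrow> bool" where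
  "tripartition V S I R \<longleftrightarrow> finite V \<and> V = S \<union> I \<union> R \<and> S \<inter> I = {} \<and> S \<inter> R = {} \<and> I \<inter> R = {}"

text \<open>For nonempty \<open>S\<close>, the distance in
  \<open>K\<^sub>s \<or> (K\<^sub>r \<union> i K\<^sub>1)\<close> with \<open>S\<close> and
  \<open>R\<close> as the two cliques. The \<open>i\<close> isolated vertices of the union are those
  in neither set.\<close>

definition split_dist :: "'a set \<Rightarrow> 'a set \<Rightarrow> 'a \<Rightarrow> 'a \<Rightarrow> nat" where
  "split_dist S R u v =
    (if u = v then 0 else if u \<in> S \<or> v \<in> S \<or> (u \<in> R \<and> v \<in> R) then 1 else 2)"

definition split_edges_on :: "'a set \<Rightarrow> 'a set set \<Rightarrow> 'a set \<Rightarrow> 'a set \<Rightarrow> bool" where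
  "split_edges_on V E S R \<longleftrightarrow> (\<forall>u\<in>V. \<forall>v\<in>V. {u, v} \<in> E \<longleftrightarrow> split_dist S R u v = 1)"

lemma sum_tripartition:
  assumes "tripartition V S I R"
  shows "sum f V = sum f S + sum f I + sum f R"
proof -
  have "finite S" "finite I" "finite R" using assms by (auto simp: tripartition_def)
  moreover have "(S \<union> I) \<inter> R = {}" "S \<inter> I = {}" "V = S \<union> I \<union> R"
    using assms by (auto simp: tripartition_def)
  ultimately show ?thesis by (simp add: sum.union_disjoint)
qed

lemma split_dist_row_sum:
  fixes x :: "'a \<Rightarrow> real"
  assumes T: "tripartition V S I R" and u: "u \<in> V"
  shows "(\<Sum>v\<in>V. split_dist S R u v * x v) = sum x V - x u
    + (if u \<in> S then 0 else sum x I + sum x R - (if u \<in> R then sum x R else x u))"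
proof -
  have fin: "finite V" using T by (auto simp: tripartition_def)
  have row: "(\<Sum>v\<in>V. split_dist S R u v * x v)
      = (\<Sum>v\<in>V. x v - (if v = u then x v else 0)
         + (if u \<notin> S \<and> v \<notin> S \<and> u \<noteq> v \<and> (u \<in> I \<or> v \<in> I) then x v else 0))"
    using T u by (intro sum.cong) (auto simp: split_dist_def tripartition_def)
  also have "\<dots> = sum x V - x u
      + (\<Sum>v\<in>V. if u \<notin> S \<and> v \<notin> S \<and> u \<noteq> v \<and> (u \<in> I \<or> v \<in> I) then x v else 0)"
    using fin u by (simp add: sum.distrib sum_subtractf)
  also have "(\<Sum>v\<in>V. if u \<notin> S \<and> v \<notin> S \<and> u \<noteq> v \<and> (u \<in> I \<or> v \<in> I) then x v else 0)
      = (if u \<in> S then 0 else sum x I + sum x R - (if u \<in> R then sum x R else x u))"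
  proof -
    consider "u \<in> S" | "u \<in> I" "u \<notin> S" "u \<notin> R" | "u \<in> R" "u \<notin> S" "u \<notin> I"
      using T u by (auto simp: tripartition_def)
    then show ?thesis
    proof cases
      case 2
      have "(\<Sum>v\<in>V. if u \<notin> S \<and> v \<notin> S \<and> u \<noteq> v \<and> (u \<in> I \<or> v \<in> I) then x v else 0)
        = (\<Sum>v\<in>V. (if v \<in> S then 0 else x v) - (if v = u then x v else 0))"
        using 2 by (intro sum.cong) auto
      also have "\<dots> = (\<Sum>v\<in>V. if v \<in> S then 0 else x v) - x u"
        using fin u by (simp add: sum_subtractf)
      also have "(\<Sum>v\<in>V. if v \<in> S then 0 else x v) = sum x I + sum x R"
      proof -
        have "(\<Sum>v\<in>I. if v \<in> S then 0 else x v) = sum x I"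
          "(\<Sum>v\<in>R. if v \<in> S then 0 else x v) = sum x R"
          using T by (auto simp: tripartition_def intro!: sum.cong)
        then show ?thesis by (simp add: sum_tripartition[OF T])
      qed
      finally show ?thesis using 2 by simp
    next
      case 3
      have "(\<Sum>v\<in>V. if u \<notin> S \<and> v \<notin> S \<and> u \<noteq> v \<and> (u \<in> I \<or> v \<in> I) then x v else 0)
        = (\<Sum>v\<in>V. if v \<in> I then x v else 0)"
        using 3 T by (intro sum.cong) (auto simp: tripartition_def)
      also have "\<dots> = sum x (V \<inter> I)" using fin by (simp add: sum.inter_restrict)
      also have "V \<inter> I = I" using T by (auto simp: tripartition_def)
      finally show ?thesis using 3 by simp
    qed auto
  qed
  finally show ?thesis .
qed

text \<open>The matrix is all ones off the diagonal, plus one more for each pair at distance 2.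
  Those pairs are all pairs in \<open>I \<union> R\<close> except the ones inside \<open>R\<close>
  and the diagonal of \<open>I\<close>, which accounts for the last three terms.\<close>

lemma split_dist_bform:
  assumes T: "tripartition V S I R"
  shows "bform_on V (\<lambda>u v. real (split_dist S R u v)) x =
    (sum x S + sum x I + sum x R)\<^sup>2 - sqnorm_on V x + (sum x I + sum x R)\<^sup>2 - (sum x R)\<^sup>2
    - (\<Sum>v\<in>I. (x v)\<^sup>2)"
proof -
  have "bform_on V (\<lambda>u v. real (split_dist S R u v)) x
      = (\<Sum>u\<in>V. x u * (\<Sum>v\<in>V. split_dist S R u v * x v))"
    unfolding bform_on_def by (simp add: sum_distrib_left algebra_simps)
  also have "\<dots> = (\<Sum>u\<in>V. x u * sum x V - (x u)\<^sup>2 + x u *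
      (if u \<in> S then 0 else sum x I + sum x R - (if u \<in> R then sum x R else x u)))"
    by (intro sum.cong refl, subst split_dist_row_sum[OF T])
       (simp_all add: algebra_simps power2_eq_square)
  also have "\<dots> = (sum x V)\<^sup>2 - sqnorm_on V x + (\<Sum>u\<in>V. x u *
      (if u \<in> S then 0 else sum x I + sum x R - (if u \<in> R then sum x R else x u)))"
    by (simp add: sum.distrib sum_subtractf sum_distrib_right[symmetric] sqnorm_on_def power2_eq_square)
  also have "(\<Sum>u\<in>V. x u *
      (if u \<in> S then 0 else sum x I + sum x R - (if u \<in> R then sum x R else x u)))
     = (\<Sum>u\<in>I. x u * (sum x I + sum x R) - (x u)\<^sup>2) + (\<Sum>u\<in>R. x u * sum x I)"
  proof -
    have "(\<Sum>u\<in>S. x u * (if u \<in> S then 0 else sum x I + sum x R - (if u \<in> R then sum x R else x u))) = 0"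
      by simp
    moreover have "(\<Sum>u\<in>I. x u * (if u \<in> S then 0 else sum x I + sum x R - (if u \<in> R then sum x R else x u)))
      = (\<Sum>u\<in>I. x u * (sum x I + sum x R) - (x u)\<^sup>2)"
      using T by (intro sum.cong) (auto simp: tripartition_def algebra_simps power2_eq_square)
    moreover have "(\<Sum>u\<in>R. x u * (if u \<in> S then 0 else sum x I + sum x R - (if u \<in> R then sum x R else x u)))
      = (\<Sum>u\<in>R. x u * sum x I)"
      using T by (intro sum.cong) (auto simp: tripartition_def)
    ultimately show ?thesis by (simp only: sum_tripartition[OF T])
  qed
  also have "\<dots> = sum x I * (sum x I + sum x R) - (\<Sum>v\<in>I. (x v)\<^sup>2) + sum x R * sum x I"
    by (simp add: sum_subtractf sum_distrib_right)
  finally show ?thesis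
    by (simp add: sum_tripartition[OF T] algebra_simps power2_eq_square)
qed

lemma split_graph_connected_gdist:
  assumes T: "tripartition V S I R" and "S \<noteq> {}" and E: "split_edges_on V E S R"
  shows "connected_graph V E"
    and "\<And>u v. u \<in> V \<Longrightarrow> v \<in> V \<Longrightarrow> gdist V E u v = split_dist S R u v"
proof -
  obtain s where s: "s \<in> S" "s \<in> V" using assms(2) T by (auto simp: tripartition_def)
  have edge: "{u, v} \<in> E" if "u \<in> V" "v \<in> V" "split_dist S R u v = 1" for u v
    using E that by (simp add: split_edges_on_def)
  have es: "{u, s} \<in> E" "{s, u} \<in> E" if "u \<in> V" "u \<noteq> s" for u
    using s that by (auto intro!: edge simp: split_dist_def)
  have "\<exists>xs. is_walk V E xs \<and> hd xs = u \<and> last xs = v" if uv: "u \<in> V" "v \<in> V" for u v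
  proof -
    consider "u = v" | "{u, v} \<in> E" | "u \<noteq> s" "v \<noteq> s" using es[of u] es[of v] uv by blast
    then show ?thesis
    proof cases
      case 1
      then show ?thesis using that by (intro exI[of _ "[u]"]) (auto simp: is_walk_def)
    next
      case 2
      then show ?thesis using that by (intro exI[of _ "[u, v]"]) (auto simp: is_walk_def)
    next
      case 3
      then show ?thesis using that es s
        by (intro exI[of _ "[u, s, v]"]) (auto simp: is_walk_def less_Suc_eq)
    qed
  qed
  then show con: "connected_graph V E" using s unfolding connected_graph_def by auto
  fix u v assume uv: "u \<in> V" "v \<in> V"
  consider "u = v" | "u \<noteq> v" "split_dist S R u v = 1" | "u \<noteq> v" "split_dist S R u v = 2"
    unfolding split_dist_def by metis
  then show "gdist V E u v = split_dist S R u v"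
  proof cases
    case 1
    then show ?thesis using uv by (simp add: split_dist_def)
  next
    case 2
    then show ?thesis using gdist_eq_1_iff[OF con uv 2(1)] edge[OF uv] by simp
  next
    case 3
    then have "{u, v} \<notin> E" using E uv by (simp add: split_edges_on_def)
    then have "gdist V E u v \<noteq> 1" using gdist_eq_1_iff[OF con uv 3(1)] by simp
    moreover have "gdist V E u v \<ge> 1" by (rule gdist_pos[OF con uv 3(1)])
    moreover have "u \<noteq> s" "v \<noteq> s" using 3 s by (auto simp: split_dist_def)
    then have "gdist V E u v \<le> 2"
      using uv s es by (intro gdist_common_neighbour[where w = s]) auto
    ultimately show ?thesis using 3 by simp
  qed
qed

text \<open>The partition \<open>S, I, R\<close> is equitable. The three equations state the
  eigenvalue problem of its quotient matrix, whose positive solution lifts to a positive eigenvector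
  constant on the parts.\<close>

lemma split_graph_spectral_radius_le:
  fixes a b c \<mu> :: real
  assumes G: "simple_graph V E" and T: "tripartition V S I R" and "S \<noteq> {}"
    and E: "split_edges_on V E S R" and pos: "a > 0" "b > 0" "c > 0"
    and eqS: "real (card S) * a - a + real (card I) * c + real (card R) * b = \<mu> * a"
    and eqI: "real (card S) * a + 2 * (real (card I) * c - c) + 2 * real (card R) * b = \<mu> * c"
    and eqR: "real (card S) * a + 2 * real (card I) * c + real (card R) * b - b = \<mu> * b"
  shows "dist_spectral_radius V E \<le> \<mu>"
proof -
  define y where "y v = (if v \<in> S then a else if v \<in> I then c else b)" for v
  have sums: "sum y S = card S * a" "sum y I = card I * c" "sum y R = card R * b"
  proof -
    have "sum y S = (\<Sum>v\<in>S. a)"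
      by (intro sum.cong) (auto simp: y_def)
    moreover have "sum y I = (\<Sum>v\<in>I. c)" "sum y R = (\<Sum>v\<in>R. b)"
      by (intro sum.cong; use T in \<open>auto simp: y_def tripartition_def\<close>)+
    ultimately show "sum y S = card S * a" "sum y I = card I * c" "sum y R = card R * b" by auto
  qed
  note gd = split_graph_connected_gdist[OF T assms(3) E]
  show ?thesis
  proof (rule dist_spectral_radius_le[OF G gd(1)])
    show "y v > 0" for v using pos by (simp add: y_def)
    fix u assume u: "u \<in> V"
    have "(\<Sum>v\<in>V. real (gdist V E u v) * y v) = (\<Sum>v\<in>V. split_dist S R u v * y v)"
      using gd(2)[OF u] by (intro sum.cong) auto
    also have "\<dots> = \<mu> * y u"
    proof -
      consider "u \<in> S" | "u \<in> I" "u \<notin> S" "u \<notin> R" | "u \<in> R" "u \<notin> S" "u \<notin> I"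
        using T u by (auto simp: tripartition_def)
      then show ?thesis
        unfolding split_dist_row_sum[OF T u] sum_tripartition[OF T] sums
        using eqS eqI eqR by cases (auto simp: y_def algebra_simps)
    qed
    finally show "(\<Sum>v\<in>V. real (gdist V E u v) * y v) = \<mu> * y u" .
  qed
qed

lemma split_graph_iso:
  assumes T: "tripartition V S I R" and T': "tripartition V' S' I' R'"
    and E: "split_edges_on V E S R" and E': "split_edges_on V' E' S' R'"
    and "card S = card S'" "card I = card I'" "card R = card R'"
  shows "graph_iso V E V' E'"
proof -
  have fin: "finite S" "finite I" "finite R" "finite S'" "finite I'" "finite R'"
    using T T' by (auto simp: tripartition_def)
  obtain f1 f2 f3 where f: "bij_betw f1 S S'" "bij_betw f2 I I'" "bij_betw f3 R R'"
    using finite_same_card_bij fin assms(5-7) by metis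
  define f where "f v = (if v \<in> S then f1 v else if v \<in> I then f2 v else f3 v)" for v
  have fS: "bij_betw f S S'" using f(1) by (rule bij_betw_cong[THEN iffD1, rotated]) (simp add: f_def)
  have fI: "bij_betw f I I'"
    using f(2) T by (intro bij_betw_cong[THEN iffD1, OF _ f(2)]) (auto simp: f_def tripartition_def)
  have fR: "bij_betw f R R'"
    using f(3) T by (intro bij_betw_cong[THEN iffD1, OF _ f(3)]) (auto simp: f_def tripartition_def)
  have "bij_betw f (S \<union> I \<union> R) (S' \<union> I' \<union> R')"
    using T' by (intro bij_betw_combine fS fI fR) (auto simp: tripartition_def)
  then have bij: "bij_betw f V V'" using T T' by (simp add: tripartition_def)
  have mem: "f v \<in> V'" "f v \<in> S' \<longleftrightarrow> v \<in> S" "f v \<in> R' \<longleftrightarrow> v \<in> R" if "v \<in> V" for v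
    using that T T' fS fI fR bij unfolding tripartition_def bij_betw_def by blast+
  have "f u = f v \<longleftrightarrow> u = v" if "u \<in> V" "v \<in> V" for u v
    using bij that by (auto simp: bij_betw_def dest: inj_onD)
  then have "split_dist S' R' (f u) (f v) = split_dist S R u v" if "u \<in> V" "v \<in> V" for u v
    using mem that by (simp add: split_dist_def)
  then show ?thesis
    unfolding graph_iso_def using bij E E' mem(1) by (intro exI[of _ f]) (simp add: split_edges_on_def)
qed

section \<open>Comparison of quadratic forms\<close>

text \<open>With \<open>S\<close> empty the label \<open>cl\<close> would be constant along every
  walk, so connectedness would leave a single class.\<close>

lemma obstruction_nonempty:
  assumes con: "connected_graph V E" and S: "card S + 2 \<le> card (cl ` (V - S))"
    and cl: "\<And>u v. u \<in> V - S \<Longrightarrow> v \<in> V - S \<Longrightarrow> {u, v} \<in> E \<Longrightarrow> cl u = cl v"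
  shows "S \<noteq> {}"
proof
  assume "S = {}"
  have const: "cl u = cl v" if uv: "u \<in> V" "v \<in> V" for u v
  proof -
    obtain xs where xs: "is_walk V E xs" "hd xs = u" "last xs = v"
      using con uv unfolding connected_graph_def by blast
    have "cl (xs ! i) = cl (xs ! 0)" if "i < length xs" for i
      using that
    proof (induction i)
      case (Suc i)
      then have "{xs ! i, xs ! Suc i} \<in> E" "xs ! i \<in> V" "xs ! Suc i \<in> V"
        using xs(1) by (auto simp: is_walk_def)
      then show ?case using Suc cl[of "xs ! i" "xs ! Suc i"] \<open>S = {}\<close> by simp
    qed simp
    from this[of "length xs - 1"] show ?thesis
      using xs by (auto simp: is_walk_def hd_conv_nth last_conv_nth)
  qed
  obtain w where "w \<in> V" using con by (auto simp: connected_graph_def)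
  then have "cl ` V \<subseteq> {cl w}" using const by blast
  then have "card (cl ` V) \<le> 1" using card_mono[of "{cl w}" "cl ` V"] by simp
  then show False using S \<open>S = {}\<close> by simp
qed

text \<open>\<open>R\<close> consists of the largest class together with the vertices not chosen as representatives. An
  unchosen vertex \<open>v\<close> outside the largest class may be adjacent to the representative of its class,
  which the split graph forbids, but it has distance at least 2 to the whole largest class, which
  then has at least two elements.\<close>

lemma obstruction_tripartition:
  assumes G: "simple_graph V E" and con: "connected_graph V E" and "even (card V)"
    and "\<nexists>p. pairing V E p"
  obtains S I R where "tripartition V S I R" "S \<noteq> {}" "R \<noteq> {}" "card I = Suc (card S)"
    and "\<And>x b. b > 0 \<Longrightarrow> \<forall>v\<in>V. x v \<ge> 0 \<Longrightarrow> \<forall>v\<in>R. x v = b \<Longrightarrow> \<forall>v\<in>I. x v \<le> 2 * b \<Longrightarrow>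
      bform_on V (\<lambda>u v. real (split_dist S R u v)) x \<le> bform_on V (\<lambda>u v. real (gdist V E u v)) x"
    and "\<And>x b. b > 0 \<Longrightarrow> \<forall>v\<in>V. x v > 0 \<Longrightarrow> \<forall>v\<in>R. x v = b \<Longrightarrow> \<forall>v\<in>I. x v < 2 * b \<Longrightarrow>
      bform_on V (\<lambda>u v. real (gdist V E u v)) x \<le> bform_on V (\<lambda>u v. real (split_dist S R u v)) x
      \<Longrightarrow> split_edges_on V E S R"
proof -
  obtain S and cl :: "'a \<Rightarrow> 'a set" where SV: "S \<subseteq> V" and S2: "card S + 2 \<le> card (cl ` (V - S))"
    and cl: "\<And>u v. u \<in> V - S \<Longrightarrow> v \<in> V - S \<Longrightarrow> {u, v} \<in> E \<Longrightarrow> cl u = cl v"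
    using tutte_obstruction[OF G assms(3,4)] by metis
  have fV: "finite V" using G by (simp add: simple_graph_def)
  have Sne: "S \<noteq> {}" using obstruction_nonempty[OF con S2 cl] .
  define F where "F = cl ` (V - S)"
  define cell where "cell C = {v \<in> V - S. cl v = C}" for C
  have finF: "finite F" using fV by (simp add: F_def)
  have "card F \<noteq> 0" using S2 by (simp add: F_def)
  then have "F \<noteq> {}" by auto
  then have "Max ((\<lambda>C. card (cell C)) ` F) \<in> (\<lambda>C. card (cell C)) ` F"
    using finF by (intro Max_in) auto
  then obtain C0 where C0: "C0 \<in> F" "card (cell C0) = Max ((\<lambda>C. card (cell C)) ` F)"
    by (metis imageE)
  then have C0max: "card (cell C) \<le> card (cell C0)" if "C \<in> F" for C
    using finF that by simp
  define P where "P = cell C0"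
  have "Suc (card S) \<le> card (F - {C0})" using S2 C0(1) finF by (simp add: F_def)
  then obtain F1 where F1: "F1 \<subseteq> F - {C0}" "card F1 = Suc (card S)"
    using finF by (meson finite_Diff obtain_subset_with_card_n)
  have "\<forall>C\<in>F. \<exists>v. v \<in> V - S \<and> cl v = C" by (auto simp: F_def)
  then obtain r where r: "\<And>C. C \<in> F \<Longrightarrow> r C \<in> V - S \<and> cl (r C) = C" by metis
  define I where "I = r ` F1"
  define R where "R = V - S - I"
  have cardI: "card I = Suc (card S)"
    unfolding I_def F1(2)[symmetric] using F1(1) r by (intro card_image) (metis DiffD1 inj_onI subsetD)
  have IV: "I \<subseteq> V - S" using r F1(1) by (auto simp: I_def)
  have Iinj: "u = v" if "u \<in> I" "v \<in> I" "cl u = cl v" for u v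
    using that r F1(1) unfolding I_def by (metis DiffD1 imageE subsetD)
  have IC0: "cl v \<noteq> C0" if "v \<in> I" for v
    using that r F1(1) unfolding I_def by (metis DiffD1 DiffD2 imageE insertI1 subsetD)
  have T: "tripartition V S I R"
    using fV SV IV by (auto simp: tripartition_def R_def)
  have PR: "P \<subseteq> R" using IC0 by (auto simp: P_def cell_def R_def)
  have fP: "finite P" using fV by (simp add: P_def cell_def)
  have "P \<noteq> {}" using C0(1) r[OF C0(1)] by (auto simp: P_def cell_def)
  then have P1: "card P \<ge> 1" using fP by (simp add: Suc_le_eq card_gt_0_iff)
  define Q where "Q = R - P"
  \<comment> \<open>\<open>A\<close> marks distances that are larger in \<open>G\<close>: both ends
    lie in \<open>R\<close>, where the split graph has distance 1, but in different classes.
    \<open>B\<close> marks the possible loss, a leftover vertex and the representative of its class,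
    where the split graph has distance 2 and \<open>G\<close> may have 1.\<close>
  define A where "A u v = (if u \<in> Q \<and> v \<in> P then 1 else 0 :: real)" for u v
  define B where "B u v = (if u \<in> Q \<and> v \<in> I \<and> cl u = cl v then 1 else 0 :: real)" for u v
  let ?g = "\<lambda>u v. real (gdist V E u v)" and ?s = "\<lambda>u v. real (split_dist S R u v)"
  have pw: "?s u v + A u v + A v u \<le> ?g u v + B u v + B v u" if uv: "u \<in> V" "v \<in> V" for u v
  proof (cases "u = v")
    case True
    then show ?thesis using uv PR by (auto simp: split_dist_def A_def B_def Q_def R_def)
  next
    case False
    have g1: "?g u v \<ge> 1" using gdist_pos[OF con uv False] by simp
    have g2: "?g u v \<ge> 2" if "u \<notin> S" "v \<notin> S" "cl u \<noteq> cl v"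
    proof -
      have "{u, v} \<notin> E" using cl[of u v] that uv by auto
      then have "gdist V E u v \<noteq> 1" using gdist_eq_1_iff[OF con uv False] by simp
      then show ?thesis using gdist_pos[OF con uv False] by simp
    qed
    consider "u \<in> S \<or> v \<in> S" | "u \<in> R" "v \<in> R" | "u \<in> I" "v \<in> I" | "u \<in> I" "v \<in> R" | "u \<in> R" "v \<in> I"
      using T uv by (auto simp: tripartition_def)
    then show ?thesis
    proof cases
      case 1
      then have "A u v = 0" "A v u = 0" "B u v = 0" "B v u = 0"
        using PR IV by (auto simp: A_def B_def Q_def R_def)
      then show ?thesis using 1 g1 by (auto simp: split_dist_def False)
    next
      case 2
      have *: "u \<notin> S" "v \<notin> S" "u \<notin> I" "v \<notin> I" using 2 by (auto simp: R_def)
      have "A u v + A v u \<le> 1" by (auto simp: A_def Q_def)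
      moreover have "A u v + A v u = 0" if "cl u = cl v"
        using 2 that by (auto simp: A_def Q_def P_def cell_def R_def)
      moreover have "B u v = 0" "B v u = 0" using * by (auto simp: B_def)
      ultimately show ?thesis using 2 g1 g2 * by (cases "cl u = cl v") (auto simp: split_dist_def False)
    next
      case 3
      then have *: "u \<notin> S" "v \<notin> S" "u \<notin> R" "v \<notin> R" using IV by (auto simp: R_def)
      have "A u v = 0" "A v u = 0" "B u v = 0" "B v u = 0"
        using * PR by (auto simp: A_def B_def Q_def)
      then show ?thesis using * g2 Iinj[of u v] 3 False by (auto simp: split_dist_def)
    next
      case 4
      then have *: "u \<notin> S" "v \<notin> S" "u \<notin> R" "v \<notin> I" using IV by (auto simp: R_def)
      have "A u v = 0" "A v u = 0" "B u v = 0"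
        using * PR by (auto simp: A_def B_def Q_def)
      moreover have "B v u = 1" if "cl u = cl v"
        using that 4 IC0[of u] by (auto simp: B_def Q_def P_def cell_def)
      moreover have "B v u \<ge> 0" by (simp add: B_def)
      ultimately show ?thesis using * g1 g2 False by (cases "cl u = cl v") (auto simp: split_dist_def)
    next
      case 5
      then have *: "u \<notin> S" "v \<notin> S" "u \<notin> I" "v \<notin> R" using IV by (auto simp: R_def)
      have "A u v = 0" "A v u = 0" "B v u = 0"
        using * PR by (auto simp: A_def B_def Q_def)
      moreover have "B u v = 1" if "cl u = cl v"
        using that 5 IC0[of v] by (auto simp: B_def Q_def P_def cell_def)
      moreover have "B u v \<ge> 0" by (simp add: B_def)
      ultimately show ?thesis using * g1 g2 False by (cases "cl u = cl v") (auto simp: split_dist_def)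
    qed
  qed
  have gain: "bform_on V ?s x + 2 * (\<Sum>u\<in>V. x u * (\<Sum>v\<in>V. (A u v - B u v) * x v)) \<le> bform_on V ?g x"
    if x: "\<forall>v\<in>V. x v \<ge> 0" for x :: "'a \<Rightarrow> real"
  proof -
    let ?D = "\<lambda>u v. A u v - B u v"
    have D: "(\<Sum>u\<in>V. x u * (\<Sum>v\<in>V. ?D u v * x v)) = (\<Sum>u\<in>V. \<Sum>v\<in>V. ?D u v * x u * x v)"
      by (simp add: sum_distrib_left algebra_simps)
    have swap: "(\<Sum>u\<in>V. \<Sum>v\<in>V. ?D v u * x u * x v) = (\<Sum>u\<in>V. \<Sum>v\<in>V. ?D u v * x u * x v)"
      by (subst sum.swap) (simp add: mult_ac)
    have "(\<Sum>u\<in>V. \<Sum>v\<in>V. (?s u v + ?D u v + ?D v u) * x u * x v)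
      = bform_on V ?s x + (\<Sum>u\<in>V. \<Sum>v\<in>V. ?D u v * x u * x v)
        + (\<Sum>u\<in>V. \<Sum>v\<in>V. ?D v u * x u * x v)"
      unfolding bform_on_def by (simp only: sum.distrib distrib_right)
    then have "bform_on V ?s x + 2 * (\<Sum>u\<in>V. \<Sum>v\<in>V. ?D u v * x u * x v)
      = (\<Sum>u\<in>V. \<Sum>v\<in>V. (?s u v + ?D u v + ?D v u) * x u * x v)"
      using swap by simp
    also have "\<dots> \<le> bform_on V ?g x"
      unfolding bform_on_def
    proof (intro sum_mono)
      fix u v assume uv: "u \<in> V" "v \<in> V"
      have "?s u v + ?D u v + ?D v u \<le> ?g u v" using pw[OF uv] by simp
      then show "(?s u v + ?D u v + ?D v u) * x u * x v \<le> ?g u v * x u * x v"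
        using x uv by (intro mult_right_mono) auto
    qed
    finally show ?thesis using D by simp
  qed
  have row0: "(\<Sum>v\<in>V. (A u v - B u v) * x v) = 0" if "u \<notin> Q" for u and x :: "'a \<Rightarrow> real"
    using that by (simp add: A_def B_def)
  \<comment> \<open>The gain \<open>b * card P\<close> is set against the value of at most one
    representative, that of the class of \<open>u\<close>. If it exists,
    \<open>card P \<ge> 2\<close>, so a value of at most \<open>2 * b\<close> is covered.\<close>
  have row: "(\<Sum>v\<in>V. (A u v - B u v) * x v) = b * card P - (\<Sum>v\<in>{v \<in> I. cl u = cl v}. x v)"
    if "u \<in> Q" "\<forall>v\<in>R. x v = b" for u b and x :: "'a \<Rightarrow> real"
  proof -
    have "(\<Sum>v\<in>V. (A u v - B u v) * x v)
      = (\<Sum>v\<in>V. (if v \<in> P then x v else 0) - (if v \<in> {v \<in> I. cl u = cl v} then x v else 0))"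
      using that(1) by (intro sum.cong) (auto simp: A_def B_def)
    also have "\<dots> = sum x (V \<inter> P) - sum x (V \<inter> {v \<in> I. cl u = cl v})"
      using fV by (simp add: sum_subtractf sum.inter_restrict)
    also have "V \<inter> P = P" using PR by (auto simp: R_def)
    also have "V \<inter> {v \<in> I. cl u = cl v} = {v \<in> I. cl u = cl v}" using IV by auto
    also have "sum x P = (\<Sum>v\<in>P. b)" using that(2) PR by (intro sum.cong) auto
    finally show ?thesis by simp
  qed
  have loss: "{v \<in> I. cl u = cl v} = {} \<or> (\<exists>v\<in>I. {v \<in> I. cl u = cl v} = {v} \<and> card P \<ge> 2)"
    if u: "u \<in> Q" for u
  proof (cases "{v \<in> I. cl u = cl v} = {}")
    case False
    then obtain v where v: "v \<in> I" "cl u = cl v" by auto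
    have uR: "u \<in> V - S" "u \<notin> I" using u by (auto simp: Q_def R_def)
    then have "{u, v} \<subseteq> cell (cl v)" using v IV by (auto simp: cell_def)
    then have "card {u, v} \<le> card (cell (cl v))"
      using fV by (intro card_mono) (auto simp: cell_def)
    also have "\<dots> \<le> card P" unfolding P_def using v IV by (intro C0max) (auto simp: F_def)
    finally have "card P \<ge> 2" using v uR by (cases "u = v") auto
    moreover have "{v \<in> I. cl u = cl v} = {v}" using Iinj v by fastforce
    ultimately show ?thesis using v by blast
  qed simp
  have two: "2 * b \<le> b * card P" if "card P \<ge> 2" "b > 0" for b :: real
    using that by (simp add: mult.commute)
  show ?thesis
  proof (rule that[OF T Sne _ cardI])
    show "R \<noteq> {}" using PR \<open>P \<noteq> {}\<close> by auto
  next
    fix x :: "'a \<Rightarrow> real" and b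
    assume b: "b > 0" and x: "\<forall>v\<in>V. x v \<ge> 0" "\<forall>v\<in>R. x v = b" "\<forall>v\<in>I. x v \<le> 2 * b"
    have N: "(\<Sum>v\<in>V. (A u v - B u v) * x v) \<ge> 0" for u
    proof (cases "u \<in> Q")
      case True
      from loss[OF True] have "(\<Sum>v\<in>{v \<in> I. cl u = cl v}. x v) \<le> b * card P"
      proof
        assume "{v \<in> I. cl u = cl v} = {}"
        then show ?thesis using b by (simp only: sum.empty) simp
      next
        assume "\<exists>v\<in>I. {v \<in> I. cl u = cl v} = {v} \<and> card P \<ge> 2"
        then obtain w where w: "w \<in> I" "{v \<in> I. cl u = cl v} = {w}" "card P \<ge> 2" by blast
        have "x w \<le> 2 * b" using x(3) w(1) by blast
        also have "\<dots> \<le> b * card P" by (rule two[OF w(3) b])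
        finally show ?thesis unfolding w(2) by simp
      qed
      then show ?thesis using row[OF True x(2)] by linarith
    qed (simp add: row0)
    have "(\<Sum>u\<in>V. x u * (\<Sum>v\<in>V. (A u v - B u v) * x v)) \<ge> 0"
      by (rule sum_nonneg, rule mult_nonneg_nonneg[OF _ N]) (use x(1) in auto)
    then show "bform_on V ?s x \<le> bform_on V ?g x" using gain[OF x(1)] by linarith
  next
    fix x :: "'a \<Rightarrow> real" and b
    assume b: "b > 0" and x: "\<forall>v\<in>V. x v > 0" "\<forall>v\<in>R. x v = b" "\<forall>v\<in>I. x v < 2 * b"
      and le: "bform_on V ?g x \<le> bform_on V ?s x"
    have x0: "\<forall>v\<in>V. x v \<ge> 0" using x(1) by (auto intro: less_imp_le)
    have pos: "(\<Sum>v\<in>V. (A u v - B u v) * x v) > 0" if "u \<in> Q" for u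
    proof -
      have "b * card P > 0" using b P1 by simp
      from loss[OF that] have "(\<Sum>v\<in>{v \<in> I. cl u = cl v}. x v) < b * card P"
      proof
        assume "{v \<in> I. cl u = cl v} = {}"
        then show ?thesis using \<open>b * card P > 0\<close> by (simp only: sum.empty)
      next
        assume "\<exists>v\<in>I. {v \<in> I. cl u = cl v} = {v} \<and> card P \<ge> 2"
        then obtain w where w: "w \<in> I" "{v \<in> I. cl u = cl v} = {w}" "card P \<ge> 2" by blast
        have "x w < 2 * b" using x(3) w(1) by blast
        also have "\<dots> \<le> b * card P" by (rule two[OF w(3) b])
        finally show ?thesis unfolding w(2) by simp
      qed
      then show ?thesis using row[OF that x(2)] by linarith
    qed
    have nn: "(\<Sum>v\<in>V. (A u v - B u v) * x v) \<ge> 0" for u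
      using pos[of u] row0[of u x] by (cases "u \<in> Q") auto
    \<comment> \<open>A vertex of \<open>Q\<close> would make the gain strictly positive, contrary
      to \<open>le\<close>. With \<open>Q\<close> empty both corrections vanish, the distances of
      \<open>G\<close> dominate entrywise, and positivity of \<open>x\<close> turns the comparison
      of the forms into equality of all distances.\<close>
    have "Q = {}"
    proof (rule ccontr)
      assume "Q \<noteq> {}"
      then obtain u where u: "u \<in> Q" by auto
      then have uV: "u \<in> V" by (auto simp: Q_def R_def)
      have "(\<Sum>u\<in>V. x u * (\<Sum>v\<in>V. (A u v - B u v) * x v)) > 0"
        using uV x(1) x0 pos[OF u] nn fV by (intro sum_pos2[of V u]) auto
      then show False using gain[OF x0] le by linarith
    qed
    then have AB: "A u v = 0" "B u v = 0" for u v by (auto simp: A_def B_def)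
    have pw': "?s u v \<le> ?g u v" if "u \<in> V" "v \<in> V" for u v
      using pw[OF that] by (simp add: AB)
    let ?d = "\<lambda>u v. (?g u v - ?s u v) * x u * x v"
    have dnn: "?d u v \<ge> 0" if "u \<in> V" "v \<in> V" for u v
      using pw'[OF that] x0 that by simp
    have "(\<Sum>u\<in>V. \<Sum>v\<in>V. ?d u v) = bform_on V ?g x - bform_on V ?s x"
      unfolding bform_on_def by (simp add: sum_subtractf left_diff_distrib)
    then have "(\<Sum>u\<in>V. \<Sum>v\<in>V. ?d u v) = 0"
      using le sum_nonneg[of V "\<lambda>u. \<Sum>v\<in>V. ?d u v"] dnn by (simp add: sum_nonneg)
    then have "\<forall>u\<in>V. (\<Sum>v\<in>V. ?d u v) = 0"
      using fV dnn by (subst (asm) sum_nonneg_eq_0_iff) (auto intro!: sum_nonneg)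
    then have d0: "?d u v = 0" if "u \<in> V" "v \<in> V" for u v
      using fV dnn that sum_nonneg_eq_0_iff[of V "?d u"] by auto
    have "gdist V E u v = split_dist S R u v" if "u \<in> V" "v \<in> V" for u v
      using d0[OF that] x(1) that by auto
    moreover have "{u, v} \<in> E \<longleftrightarrow> gdist V E u v = 1" if "u \<in> V" "v \<in> V" for u v
    proof (cases "u = v")
      case True
      have "{u} \<notin> E" using G by (fastforce simp: simple_graph_def)
      then show ?thesis using True that by simp
    qed (use gdist_eq_1_iff[OF con that] in simp)
    ultimately show "split_edges_on V E S R" by (simp add: split_edges_on_def)
  qed
qed

section \<open>The extremal graphs\<close>

definition three_valued :: "'a set \<Rightarrow> 'a set \<Rightarrow> real \<Rightarrow> real \<Rightarrow> real \<Rightarrow> 'a \<Rightarrow> real" where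
  "three_valued S I a c b v = (if v \<in> S then a else if v \<in> I then c else b)"

lemma three_valued_forms:
  fixes a b c :: real
  assumes T: "tripartition V S I R"
  shows "sqnorm_on V (three_valued S I a c b) = card S * a\<^sup>2 + card I * c\<^sup>2 + card R * b\<^sup>2"
    and "bform_on V (\<lambda>u v. real (split_dist S R u v)) (three_valued S I a c b) =
      (card S * a + card I * c + card R * b)\<^sup>2 - (card S * a\<^sup>2 + card I * c\<^sup>2 + card R * b\<^sup>2)
      + (card I * c + card R * b)\<^sup>2 - (card R * b)\<^sup>2 - card I * c\<^sup>2"
proof -
  let ?x = "three_valued S I a c b"
  have S: "?x v = a" if "v \<in> S" for v using that by (simp add: three_valued_def)
  have I: "?x v = c" if "v \<in> I" for v using that T by (auto simp: three_valued_def tripartition_def)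
  have R: "?x v = b" if "v \<in> R" for v using that T by (auto simp: three_valued_def tripartition_def)
  have sums: "sum ?x S = card S * a" "sum ?x I = card I * c" "sum ?x R = card R * b"
    using S I R by simp_all
  have sq: "(\<Sum>v\<in>S. (?x v)\<^sup>2) = card S * a\<^sup>2" "(\<Sum>v\<in>I. (?x v)\<^sup>2) = card I * c\<^sup>2"
    "(\<Sum>v\<in>R. (?x v)\<^sup>2) = card R * b\<^sup>2"
    using S I R by simp_all
  show norm: "sqnorm_on V ?x = card S * a\<^sup>2 + card I * c\<^sup>2 + card R * b\<^sup>2"
    by (simp add: sqnorm_on_def sum_tripartition[OF T] sq)
  show "bform_on V (\<lambda>u v. real (split_dist S R u v)) ?x =
      (card S * a + card I * c + card R * b)\<^sup>2 - (card S * a\<^sup>2 + card I * c\<^sup>2 + card R * b\<^sup>2)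
      + (card I * c + card R * b)\<^sup>2 - (card R * b)\<^sup>2 - card I * c\<^sup>2"
    by (simp add: split_dist_bform[OF T] norm sums sq)
qed

lemma card_tripartition:
  assumes "tripartition V S I R"
  shows "card V = card S + card I + card R"
  using sum_tripartition[OF assms, of "\<lambda>_. 1::nat"] by simp

text \<open>One of the independent vertices, \<open>n-1\<close>, serves as a clique of size one,
  which places this graph in the split family at \<open>r = 1\<close>.\<close>

lemma S_edges_split:
  assumes "s < n"
  shows "simple_graph (cverts n) (S_edges n s)"
    and "tripartition (cverts n) {0..<s} {s..<n-1} {n-1}"
    and "split_edges_on (cverts n) (S_edges n s) {0..<s} {n-1}"
proof -
  show "simple_graph (cverts n) (S_edges n s)"
    unfolding simple_graph_def cverts_def S_edges_def by fastforce
  show "tripartition (cverts n) {0..<s} {s..<n-1} {n-1}"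
    using assms by (auto simp: tripartition_def cverts_def)
  have "{u, v} \<in> S_edges n s \<longleftrightarrow> u < n \<and> v < n \<and> u \<noteq> v \<and> (u < s \<or> v < s)" for u v
  proof
    assume "{u, v} \<in> S_edges n s"
    then show "u < n \<and> v < n \<and> u \<noteq> v \<and> (u < s \<or> v < s)"
      by (auto simp: S_edges_def doubleton_eq_iff)
  qed (unfold S_edges_def, blast)
  then show "split_edges_on (cverts n) (S_edges n s) {0..<s} {n-1}"
    by (auto simp: split_edges_on_def cverts_def split_dist_def)
qed

lemma H_edges_split:
  assumes "n \<ge> 4"
  shows "simple_graph (cverts n) (H_edges n)"
    and "tripartition (cverts n) {0} {n-2, n-1} {1..n-3}"
    and "split_edges_on (cverts n) (H_edges n) {0} {1..n-3}"
proof -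
  show "simple_graph (cverts n) (H_edges n)"
    unfolding simple_graph_def cverts_def H_edges_def by fastforce
  show "tripartition (cverts n) {0} {n-2, n-1} {1..n-3}"
    using assms by (auto simp: tripartition_def cverts_def)
  have "{u, v} \<in> H_edges n \<longleftrightarrow>
      u < n \<and> v < n \<and> u \<noteq> v \<and> (u = 0 \<or> v = 0 \<or> (u \<le> n - 3 \<and> v \<le> n - 3))" for u v
  proof
    assume "{u, v} \<in> H_edges n"
    then show "u < n \<and> v < n \<and> u \<noteq> v \<and> (u = 0 \<or> v = 0 \<or> (u \<le> n - 3 \<and> v \<le> n - 3))"
      by (auto simp: H_edges_def doubleton_eq_iff)
  qed (unfold H_edges_def, blast)
  then show "split_edges_on (cverts n) (H_edges n) {0} {1..n-3}"
    by (auto simp: split_edges_on_def cverts_def split_dist_def)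
qed

text \<open>With \<open>k = 25 / n\<close> the cubic takes the value \<open>23 n - 155 - 62 k + 17 k\<^sup>2 - k\<^sup>3\<close> at the right end
  of the interval. The upper bound on \<open>\<mu>\<close> separates it from the spectral radius of
  \<open>S\<^bsub>n,n/2-1\<^esub>\<close>, which for \<open>n = 10\<close> is tight (\<open>12.45\<dots> < 12.5 < 12.52\<dots>\<close>).\<close>

lemma H_eigenvector:
  fixes n :: real
  assumes n: "n \<ge> 10"
  obtains \<mu> a b c :: real where "n \<le> \<mu>" "\<mu> \<le> n + 5 - 25 / n" "a > 0" "b > 0" "c > 0"
    "c < 2 * b" "c * (\<mu> + 2) = b * (\<mu> + n - 2)"
    "2 * c + (n - 3) * b = \<mu> * a" "a + 2 * c + 2 * (n - 3) * b = \<mu> * c"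
    "a + 4 * c + (n - 4) * b = \<mu> * b"
proof -
  \<comment> \<open>Subtracting the eigenvalue equations for leaves and clique gives
    \<open>c * (\<mu> + 2) = b * (\<mu> + n - 2)\<close>; those for clique and centre give
    \<open>a = b - 2 * c / (\<mu> + 1)\<close>. With \<open>b = (\<mu> + 1) * (\<mu> + 2)\<close>,
    chosen to clear denominators, the remaining equation reads
    \<open>\<phi> \<mu> = 0\<close>.\<close>
  define \<phi> where "\<phi> t = (t + 1) * (t + 2) * (t - n + 3) - 2 * (t + n - 2) * (2 * t + 1)" for t
  define k where "k = 25 / n"
  have k: "n * k = 25" "0 < k" "k \<le> 5 / 2" using n by (auto simp: k_def field_simps)
  have "\<phi> n \<le> 0"
  proof -
    have "\<phi> n = - n * (5 * n - 13) + 10" by (simp add: \<phi>_def algebra_simps)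
    moreover have "n * (5 * n - 13) \<ge> 10 * 37" using n by (intro mult_mono) auto
    ultimately show ?thesis by simp
  qed
  moreover have "0 \<le> \<phi> (n + 5 - k)"
  proof -
    have "\<phi> (n + 5 - k) = 23 * n - 155 - 62 * k + 17 * k\<^sup>2 - k ^ 3
      - (n * k - 25) * (n + 17 - 2 * k)"
      by (simp add: \<phi>_def algebra_simps power2_eq_square power3_eq_cube)
    also have "\<dots> = 23 * n - 155 - 62 * k + k\<^sup>2 * (17 - k)"
      using k by (simp add: algebra_simps power2_eq_square power3_eq_cube)
    also have "\<dots> \<ge> 75 - 62 * k + k\<^sup>2 * (29 / 2)"
    proof -
      have "k\<^sup>2 * (29 / 2) \<le> k\<^sup>2 * (17 - k)" using k by (intro mult_left_mono) auto
      then show ?thesis using n by linarith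
    qed
    moreover have "75 - 62 * k + k\<^sup>2 * (29 / 2) = (29 / 2) * (k - 62 / 29)\<^sup>2 + (75 - 62\<^sup>2 / 58)"
      by (simp add: power2_eq_square algebra_simps)
    moreover have "(29 / 2) * (k - 62 / 29)\<^sup>2 + (75 - 62\<^sup>2 / 58) \<ge> (0::real)"
      by (intro add_nonneg_nonneg) (auto simp: power2_eq_square)
    ultimately show ?thesis by linarith
  qed
  moreover have "n \<le> n + 5 - k" using k by simp
  moreover have "continuous_on {n..n + 5 - k} \<phi>"
    unfolding \<phi>_def by (intro continuous_intros)
  ultimately obtain \<mu> where \<mu>: "n \<le> \<mu>" "\<mu> \<le> n + 5 - k" "\<phi> \<mu> = 0"
    using IVT'[of \<phi> n 0 "n + 5 - k"] by blast
  define b where "b = (\<mu> + 1) * (\<mu> + 2)"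
  define c where "c = (\<mu> + 1) * (\<mu> + n - 2)"
  define a where "a = b - 2 * (\<mu> + n - 2)"
  show ?thesis
  proof (rule that[where \<mu> = \<mu> and a = a and b = b and c = c])
    show "n \<le> \<mu>" "\<mu> \<le> n + 5 - 25 / n" using \<mu> by (auto simp: k_def)
    show "b > 0" "c > 0" using \<mu> n by (auto simp: b_def c_def)
    have "11 * (\<mu> + 2) \<le> b" unfolding b_def using \<mu> n by (intro mult_right_mono) auto
    then show "a > 0" unfolding a_def using \<mu>(1) n by (simp add: algebra_simps)
    have "(\<mu> + 1) * (\<mu> + n - 2) < (\<mu> + 1) * (2 * (\<mu> + 2))"
      using \<mu> n by (intro mult_strict_left_mono) auto
    then show "c < 2 * b" by (simp add: b_def c_def algebra_simps)
    show "c * (\<mu> + 2) = b * (\<mu> + n - 2)" by (simp add: b_def c_def algebra_simps)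
    show "2 * c + (n - 3) * b = \<mu> * a" "a + 2 * c + 2 * (n - 3) * b = \<mu> * c"
      "a + 4 * c + (n - 4) * b = \<mu> * b"
      using \<mu>(3) by (simp_all add: a_def b_def c_def \<phi>_def algebra_simps)
  qed
qed

text \<open>The vector with value \<open>a\<close> on the \<open>s\<close> clique vertices and 1 on
  the \<open>s + 2\<close> others gives \<open>\<mu> = s * a + 2 * s + 2\<close> and
  \<open>\<mu> * a = (s - 1) * a + s + 2\<close>. Eliminating \<open>\<mu>\<close> leaves this
  quadratic.\<close>

lemma S_eigenvector:
  fixes s :: real
  assumes "2 \<le> s" "s \<le> 3"
  obtains a where "3 / 5 \<le> a" "a \<le> 13 / 20" "s * a\<^sup>2 + (s + 3) * a = s + 2"
proof -
  define \<phi> where "\<phi> t = s * t\<^sup>2 + (s + 3) * t" for t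
  have "\<phi> (3 / 5) \<le> s + 2" "s + 2 \<le> \<phi> (13 / 20)"
    using assms by (auto simp: \<phi>_def power2_eq_square field_simps)
  moreover have "continuous_on {3 / 5..13 / 20} \<phi>"
    unfolding \<phi>_def by (intro continuous_intros)
  ultimately show ?thesis
    using IVT'[of \<phi> "3 / 5" "s + 2" "13 / 20"] that by (auto simp: \<phi>_def)
qed

lemma spectral_radius_obstruction_S:
  fixes V :: "'a set"
  assumes G: "simple_graph V E" and con: "connected_graph V E" and n: "card V = n"
    and n68: "n = 6 \<or> n = 8" and no: "\<nexists>p. pairing V E p"
    and le: "dist_spectral_radius V E \<le> dist_spectral_radius (cverts n) (S_edges n (n div 2 - 1))"
  shows "graph_iso V E (cverts n) (S_edges n (n div 2 - 1))"
proof -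
  have ev: "even (card V)" using n n68 by auto
  define s where "s = n div 2 - 1"
  have s: "n = 2 * s + 2" "s = 2 \<or> s = 3" using n68 by (auto simp: s_def)
  then have sn: "s < n" by simp
  have "2 \<le> real s" "real s \<le> 3" using s(2) by auto
  from S_eigenvector[OF this] obtain a
    where a: "3 / 5 \<le> a" "a \<le> 13 / 20" "real s * a\<^sup>2 + (real s + 3) * a = real s + 2"
    by blast
  define \<mu> where "\<mu> = s * a + 2 * s + 2"
  have \<mu>a: "\<mu> * a = s * a - a + s + 2"
    using a(3) by (simp add: \<mu>_def algebra_simps power2_eq_square)
  have "dist_spectral_radius (cverts n) (S_edges n s) \<le> \<mu>"
  proof (rule split_graph_spectral_radius_le[where a = a and b = 1 and c = 1, OF S_edges_split(1,2)[OF sn] _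
        S_edges_split(3)[OF sn]])
    show "{0..<s} \<noteq> {}" using s(2) by auto
    have "card {s..<n-1} = Suc s" using s by simp
    then show "real (card {0..<s}) * a - a + real (card {s..<n-1}) * 1 + real (card {n-1}) * 1 = \<mu> * a"
      "real (card {0..<s}) * a + 2 * (real (card {s..<n-1}) * 1 - 1) + 2 * real (card {n-1}) * 1 = \<mu> * 1"
      "real (card {0..<s}) * a + 2 * real (card {s..<n-1}) * 1 + real (card {n-1}) * 1 - 1 = \<mu> * 1"
      using \<mu>a by (simp_all add: \<mu>_def)
  qed (use a in auto)
  then have rho: "dist_spectral_radius V E \<le> \<mu>" using le by (simp add: s_def)
  obtain S I R where T: "tripartition V S I R" and ne: "S \<noteq> {}" "R \<noteq> {}" and I: "card I = Suc (card S)"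
    and form: "\<And>x b. b > 0 \<Longrightarrow> \<forall>v\<in>V. x v \<ge> 0 \<Longrightarrow> \<forall>v\<in>R. x v = b \<Longrightarrow> \<forall>v\<in>I. x v \<le> 2 * b \<Longrightarrow>
      bform_on V (\<lambda>u v. real (split_dist S R u v)) x \<le> bform_on V (\<lambda>u v. real (gdist V E u v)) x"
    and eq: "\<And>x b. b > 0 \<Longrightarrow> \<forall>v\<in>V. x v > 0 \<Longrightarrow> \<forall>v\<in>R. x v = b \<Longrightarrow> \<forall>v\<in>I. x v < 2 * b \<Longrightarrow>
      bform_on V (\<lambda>u v. real (gdist V E u v)) x \<le> bform_on V (\<lambda>u v. real (split_dist S R u v)) x
      \<Longrightarrow> split_edges_on V E S R"
    by (rule obstruction_tripartition[OF G con ev no]) (rule that)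
  have fin: "finite S" "finite R" using T by (auto simp: tripartition_def)
  have cards: "card S > 0" "card R > 0" "n = 2 * card S + 1 + card R"
    using ne fin card_tripartition[OF T] I n by (auto simp: card_gt_0_iff)
  have IR: "v \<notin> S \<and> v \<notin> I" if "v \<in> R" for v using that T by (auto simp: tripartition_def)
  have IS: "v \<notin> S" if "v \<in> I" for v using that T by (auto simp: tripartition_def)
  note up = bform_le_of_dist_spectral_radius_le[OF G con rho]
  show ?thesis
  proof (cases "card S = s")
    case True
    have R1: "card R = 1" using cards(3) True s(1) by simp
    \<comment> \<open>This is the exact Perron vector of the extremal graph, so the Rayleigh bound
      for \<open>G\<close> yields precisely the reverse inequality of forms required by the equality
      case.\<close>
    let ?x = "three_valued S I a 1 1"
    have "bform_on V (\<lambda>u v. real (split_dist S R u v)) ?x = \<mu> * sqnorm_on V ?x"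
    proof -
      have "\<mu> * (s * a\<^sup>2 + (s + 2)) = (\<mu> * a) * s * a + \<mu> * (s + 2)"
        by (simp add: algebra_simps power2_eq_square)
      then show ?thesis
        unfolding three_valued_forms[OF T] I True R1 \<mu>a
        by (simp add: \<mu>_def algebra_simps power2_eq_square)
    qed
    then have "bform_on V (\<lambda>u v. real (gdist V E u v)) ?x
        \<le> bform_on V (\<lambda>u v. real (split_dist S R u v)) ?x"
      using up[of ?x] by simp
    then have "split_edges_on V E S R"
      using a IR IS by (intro eq[of 1 ?x]) (auto simp: three_valued_def)
    then have "graph_iso V E (cverts n) (S_edges n s)"
      using True I R1 s(1)
      by (intro split_graph_iso[OF T S_edges_split(2)[OF sn] _ S_edges_split(3)[OF sn]]) auto
    then show ?thesis by (simp add: s_def)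
  next
    case False
    \<comment> \<open>One integer vector serves all three competitors. For
      \<open>(card S, card R)\<close> equal to \<open>(1, 3)\<close>, \<open>(1, 5)\<close>,
      \<open>(2, 3)\<close> its Rayleigh quotients are \<open>808/107\<close>,
      \<open>1400/139\<close>, \<open>1458/141\<close>. They exceed the bound
      \<open>53 / 20 * s + 2\<close> obtained from \<open>a \<le> 13 / 20\<close>, which is 7.3 for
      \<open>n = 6\<close> and 9.95 for \<open>n = 8\<close>.\<close>
    let ?x = "three_valued S I 3 5 4"
    have "bform_on V (\<lambda>u v. real (split_dist S R u v)) ?x \<le> \<mu> * sqnorm_on V ?x"
      using IR IS by (intro order_trans[OF form[of 4 ?x] up]) (auto simp: three_valued_def)
    moreover have "\<mu> * sqnorm_on V ?x \<le> (53 / 20 * s + 2) * sqnorm_on V ?x"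
      using a(2) s(2) by (intro mult_right_mono) (auto simp: \<mu>_def sqnorm_on_def sum_nonneg)
    moreover have "card S = 1 \<and> s = 2 \<and> card R = 3 \<or> card S = 1 \<and> s = 3 \<and> card R = 5
        \<or> card S = 2 \<and> s = 3 \<and> card R = 3"
      using False cards s by presburger
    ultimately show ?thesis
      unfolding three_valued_forms[OF T] I by (elim disjE) auto
  qed
qed

lemma spectral_radius_obstruction_H:
  fixes V :: "'a set"
  assumes G: "simple_graph V E" and con: "connected_graph V E" and n: "card V = n"
    and "even n" and n10: "n \<ge> 10" and no: "\<nexists>p. pairing V E p"
    and le: "dist_spectral_radius V E \<le> dist_spectral_radius (cverts n) (H_edges n)"
  shows "graph_iso V E (cverts n) (H_edges n)"
proof -
  have ev: "even (card V)" using n \<open>even n\<close> by simp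
  have "10 \<le> real n" using n10 by simp
  note H = H_eigenvector[OF this]
  obtain \<mu> a b c :: real where \<mu>: "real n \<le> \<mu>" "\<mu> \<le> real n + 5 - 25 / real n" and abc: "a > 0" "b > 0" "c > 0"
    and cb: "c < 2 * b" "c * (\<mu> + 2) = b * (\<mu> + real n - 2)"
    and eqS: "2 * c + (real n - 3) * b = \<mu> * a"
    and eqI: "a + 2 * c + 2 * (real n - 3) * b = \<mu> * c"
    and eqR: "a + 4 * c + (real n - 4) * b = \<mu> * b"
    by (rule H) (rule that)
  have n4: "n \<ge> 4" using n10 by simp
  have cardH: "card {n-2, n-1} = 2" "card {1..n-3} = n - 3" using n10 by auto
  have rn: "real (n - 3) = real n - 3" using n10 by simp
  have "dist_spectral_radius (cverts n) (H_edges n) \<le> \<mu>"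
  proof (rule split_graph_spectral_radius_le[where a = a and b = b and c = c, OF H_edges_split(1,2)[OF n4] _
        H_edges_split(3)[OF n4] abc])
    show "real (card {0::nat}) * a - a + real (card {n-2, n-1}) * c + real (card {1..n-3}) * b = \<mu> * a"
      "real (card {0::nat}) * a + 2 * (real (card {n-2, n-1}) * c - c) + 2 * real (card {1..n-3}) * b = \<mu> * c"
      "real (card {0::nat}) * a + 2 * real (card {n-2, n-1}) * c + real (card {1..n-3}) * b - b = \<mu> * b"
      unfolding cardH rn using eqS eqI eqR by (simp_all add: algebra_simps)
  qed simp
  then have rho: "dist_spectral_radius V E \<le> \<mu>" using le by simp
  obtain S I R where T: "tripartition V S I R" and ne: "S \<noteq> {}" "R \<noteq> {}" and I: "card I = Suc (card S)"
    and form: "\<And>x b. b > 0 \<Longrightarrow> \<forall>v\<in>V. x v \<ge> 0 \<Longrightarrow> \<forall>v\<in>R. x v = b \<Longrightarrow> \<forall>v\<in>I. x v \<le> 2 * b \<Longrightarrow>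
      bform_on V (\<lambda>u v. real (split_dist S R u v)) x \<le> bform_on V (\<lambda>u v. real (gdist V E u v)) x"
    and eq: "\<And>x b. b > 0 \<Longrightarrow> \<forall>v\<in>V. x v > 0 \<Longrightarrow> \<forall>v\<in>R. x v = b \<Longrightarrow> \<forall>v\<in>I. x v < 2 * b \<Longrightarrow>
      bform_on V (\<lambda>u v. real (gdist V E u v)) x \<le> bform_on V (\<lambda>u v. real (split_dist S R u v)) x
      \<Longrightarrow> split_edges_on V E S R"
    by (rule obstruction_tripartition[OF G con ev no]) (rule that)
  have fin: "finite S" "finite I" "finite R" using T by (auto simp: tripartition_def)
  have cards: "card S > 0" "card R > 0" "n = 2 * card S + 1 + card R"
    using ne fin card_tripartition[OF T] I n by (auto simp: card_gt_0_iff)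
  have IR: "v \<notin> S \<and> v \<notin> I" if "v \<in> R" for v using that T by (auto simp: tripartition_def)
  have IS: "v \<notin> S" if "v \<in> I" for v using that T by (auto simp: tripartition_def)
  note up = bform_le_of_dist_spectral_radius_le[OF G con rho]
  define s r where "s = card S" and "r = card R"
  have sr: "s \<ge> 1" "r \<ge> 1" "n = 2 * s + 1 + r" using cards by (auto simp: s_def r_def)
  have rn': "real n = 2 * s + 1 + r" using sr(3) by simp
  show ?thesis
  proof (cases "s = 1")
    case True
    let ?x = "three_valued S I a c b"
    have rr: "real r = real n - 3" using rn' True by simp
    have "bform_on V (\<lambda>u v. real (split_dist S R u v)) ?x = \<mu> * sqnorm_on V ?x"
    proof -
      have "\<mu> * (a\<^sup>2 + 2 * c\<^sup>2 + (real n - 3) * b\<^sup>2) = (\<mu> * a) * a + 2 * (\<mu> * c) * c + (real n - 3) * (\<mu> * b) * b"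
        by (simp add: algebra_simps power2_eq_square)
      then show ?thesis
        unfolding three_valued_forms[OF T] I s_def[symmetric] r_def[symmetric] True rr
          eqS[symmetric] eqI[symmetric] eqR[symmetric]
        by (simp add: algebra_simps power2_eq_square)
    qed
    then have "bform_on V (\<lambda>u v. real (gdist V E u v)) ?x
        \<le> bform_on V (\<lambda>u v. real (split_dist S R u v)) ?x"
      using up[of ?x] by simp
    then have "split_edges_on V E S R"
      using abc cb IR IS by (intro eq[of b ?x]) (auto simp: three_valued_def)
    then show ?thesis
      using True I sr n10 cardH
      by (intro split_graph_iso[OF T H_edges_split(2)[OF n4] _ H_edges_split(3)[OF n4]])
         (auto simp: s_def r_def)
  next
    case False
    then have s2: "s \<ge> 2" using sr by simp
    \<comment> \<open>Test vector: the Perron vector of the extremal graph, its centre placed in \<open>S\<close> and its two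
      leaves in \<open>I\<close>.\<close>
    have cross: "b * (real s - 2 + 2 * real r) \<le> 4 * c"
    proof -
      obtain s0 where s0: "s0 \<in> S" using ne by auto
      obtain J where J: "J \<subseteq> I" "card J = 2"
        using obtain_subset_with_card_n[of 2 I] I s2 by (auto simp: s_def)
      define x where "x v = (if v = s0 then a else if v \<in> J then c else b)" for v
      have s0': "s0 \<notin> I" "s0 \<notin> R" using s0 T by (auto simp: tripartition_def)
      have JR: "v \<notin> J" if "v \<in> S \<union> R" for v using that J IR IS by auto
      have sumS: "(\<Sum>v\<in>S. f (x v)) = f a + (real s - 1) * f b" for f :: "real \<Rightarrow> real"
      proof -
        have "(\<Sum>v\<in>S. f (x v)) = f (x s0) + (\<Sum>v\<in>S - {s0}. f (x v))"
          using s0 fin by (simp add: sum.remove)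
        also have "(\<Sum>v\<in>S - {s0}. f (x v)) = (\<Sum>v\<in>S - {s0}. f b)"
          using JR by (intro sum.cong) (auto simp: x_def)
        finally show ?thesis using s0 fin sr by (simp add: x_def s_def of_nat_diff)
      qed
      have sumI: "(\<Sum>v\<in>I. f (x v)) = 2 * f c + (real s - 1) * f b" for f :: "real \<Rightarrow> real"
      proof -
        have "(\<Sum>v\<in>I. f (x v)) = (\<Sum>v\<in>I - J. f (x v)) + (\<Sum>v\<in>J. f (x v))"
          using J fin by (simp add: sum.subset_diff)
        also have "(\<Sum>v\<in>I - J. f (x v)) = (\<Sum>v\<in>I - J. f b)"
          using s0' by (intro sum.cong) (auto simp: x_def)
        also have "(\<Sum>v\<in>J. f (x v)) = (\<Sum>v\<in>J. f c)"
          using s0' J by (intro sum.cong) (auto simp: x_def)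
        finally show ?thesis
          using J fin I s2 by (simp add: card_Diff_subset finite_subset[OF J(1)] s_def of_nat_diff)
      qed
      have sumR: "(\<Sum>v\<in>R. f (x v)) = r * f b" for f :: "real \<Rightarrow> real"
      proof -
        have "(\<Sum>v\<in>R. f (x v)) = (\<Sum>v\<in>R. f b)"
          using JR s0' by (intro sum.cong) (auto simp: x_def)
        then show ?thesis by (simp add: r_def)
      qed
      note sums = sumS[of "\<lambda>t. t"] sumI[of "\<lambda>t. t"] sumR[of "\<lambda>t. t"]
        sumS[of "\<lambda>t. t\<^sup>2"] sumI[of "\<lambda>t. t\<^sup>2"] sumR[of "\<lambda>t. t\<^sup>2"]
      have norm: "sqnorm_on V x = a\<^sup>2 + 2 * c\<^sup>2 + (real n - 3) * b\<^sup>2"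
        unfolding sqnorm_on_def sum_tripartition[OF T] sums rn' by (simp add: algebra_simps)
      have "bform_on V (\<lambda>u v. real (split_dist S R u v)) x \<le> \<mu> * sqnorm_on V x"
        using abc cb IR s0' JR
        by (intro order_trans[OF form[of b x] up]) (auto simp: x_def)
      also have "\<mu> * sqnorm_on V x = (\<mu> * a) * a + 2 * (\<mu> * c) * c + (real n - 3) * (\<mu> * b) * b"
        unfolding norm by (simp add: algebra_simps power2_eq_square)
      also have "\<dots> = (2 * c + (real n - 3) * b) * a + 2 * (a + 2 * c + 2 * (real n - 3) * b) * c
          + (real n - 3) * (a + 4 * c + (real n - 4) * b) * b"
        unfolding eqS eqI eqR ..
      \<comment> \<open>Relative to the extremal graph, \<open>s - 1\<close> vertices of value
        \<open>b\<close> have moved from the clique into \<open>S\<close> and as many into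
        \<open>I\<close>. The former come closer to the two leaves, which costs
        \<open>4 * c\<close>; the latter move away from each other and from \<open>R\<close>, which
        gains \<open>b * (s - 2 + 2 * r)\<close>, both up to the common factor
        \<open>(s - 1) * b\<close>.\<close>
      finally have "(real s - 1) * b * (b * (real s - 2 + 2 * real r) - 4 * c) \<le> 0"
        unfolding split_dist_bform[OF T] norm sums rn'
        by (simp add: algebra_simps power2_eq_square)
      moreover have "(real s - 1) * b > 0" using s2 abc by simp
      ultimately have "b * (real s - 2 + 2 * real r) - 4 * c \<le> 0"
        by (metis linorder_not_le mult_pos_pos)
      then show ?thesis by simp
    qed
    have small: "real s - 2 + 2 * real r < 8"
    proof (rule ccontr)
      assume "\<not> ?thesis"
      then have "b * 8 \<le> b * (real s - 2 + 2 * real r)" using abc by (intro mult_left_mono) auto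
      then show False using cross cb by linarith
    qed
    have "s + 2 * r < 10" using small by linarith
    \<comment> \<open>Evenness of \<open>n = 2 * s + 1 + r\<close> makes \<open>r\<close> odd, so
      together with \<open>s + 2 * r < 10\<close> and \<open>n \<ge> 10\<close> only
      \<open>r = 1\<close> and \<open>r = 3\<close> are possible.\<close>
    then have "s = 3 \<and> r = 3 \<and> n = 10 \<or> s = 4 \<and> r = 1 \<and> n = 10 \<or> s = 5 \<and> r = 1 \<and> n = 12
        \<or> s = 6 \<and> r = 1 \<and> n = 14 \<or> s = 7 \<and> r = 1 \<and> n = 16"
      using sr n10 \<open>even n\<close> by presburger
    then consider "s = 3" "r = 3" "n = 10" | "s \<in> {4, 5, 6, 7}" "r = 1" "n = 2 * s + 2" by auto
    then show ?thesis
    proof cases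
      case 1
      \<comment> \<open>Here \<open>cross\<close> says \<open>7 * b \<le> 4 * c\<close>. The exact
        ratio of \<open>c\<close> to \<open>b\<close> is sharper than \<open>c < 2 * b\<close> and
        would force \<open>\<mu> \<le> 6\<close>.\<close>
      have "b * 7 * (\<mu> + 2) \<le> 4 * c * (\<mu> + 2)"
        using cross 1 \<mu> by (intro mult_right_mono) auto
      also have "\<dots> = b * (4 * (\<mu> + 8))" using cb(2) 1 by (simp add: algebra_simps)
      finally have "b * (7 * (\<mu> + 2)) \<le> b * (4 * (\<mu> + 8))" by (simp add: mult.assoc)
      then have "7 * (\<mu> + 2) \<le> 4 * (\<mu> + 8)" using abc by simp
      then show ?thesis using \<mu>(1) 1 by simp
    next
      case 2
      \<comment> \<open>With \<open>r = 1\<close> the competitor is the extremal graph of the small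
        orders. The ratio \<open>5/8\<close> approximates the root \<open>a\<close> of its
        quadratic. In the tightest case, \<open>n = 10\<close>, the quotient is
        \<open>6060/484\<close>, just above the bound \<open>12.5\<close> for
        \<open>\<mu>\<close>.\<close>
      let ?x = "three_valued S I 5 8 8"
      have "bform_on V (\<lambda>u v. real (split_dist S R u v)) ?x \<le> \<mu> * sqnorm_on V ?x"
        using IR IS by (intro order_trans[OF form[of 8 ?x] up]) (auto simp: three_valued_def)
      moreover have "\<mu> * sqnorm_on V ?x \<le> (n + 5 - 25 / n) * sqnorm_on V ?x"
        using \<mu>(2) by (intro mult_right_mono) (auto simp: sqnorm_on_def sum_nonneg)
      ultimately show ?thesis
        using 2 unfolding three_valued_forms[OF T] I s_def[symmetric] r_def[symmetric] by auto
    qed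
  qed
qed

theorem theorem1:
  fixes V :: "'a set" and E :: "'a set set" and k n :: nat
  assumes "odd k"
    and "simple_graph V E" and "connected_graph V E"
    and "card V = n" and "even n" and "n \<ge> 6"
  shows "(6 \<le> n \<and> n \<le> 8 \<and>
            dist_spectral_radius V E \<le> dist_spectral_radius (cverts n) (S_edges n (n div 2 - 1))
          \<longrightarrow> has_perfect_k_matching V E k \<or> graph_iso V E (cverts n) (S_edges n (n div 2 - 1)))
       \<and> (n \<ge> 10 \<and>
            dist_spectral_radius V E \<le> dist_spectral_radius (cverts n) (H_edges n)
          \<longrightarrow> has_perfect_k_matching V E k \<or> graph_iso V E (cverts n) (H_edges n))"
proof (cases "\<exists>p. pairing V E p")
  case True
  then show ?thesis using perfect_k_matching_of_pairing[OF assms(2)] by blast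
next
  case False
  have "n = 6 \<or> n = 8" if "n \<le> 8" using that assms(5,6) by presburger
  then show ?thesis
    using spectral_radius_obstruction_S[OF assms(2-4) _ False]
      spectral_radius_obstruction_H[OF assms(2-5) _ False] by blast
qed

end
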